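(* Let $W(\tau)\subset\mathrm{Bir}(\mathbb{P}^3)$ be the tile group, i.e. the image of the homomorphism $W\rtimes\mathbb{Z}/2\mathbb{Z}\to\mathrm{Bir}(\mathbb{P}^3)$ described in the context, and denote by $r_1,r_2,r_3,\tau\in W(\tau)$ the images of the simple reflections $r_1,r_2,r_3$ and of the anti-transposition $\tau$. In the homogeneous coordinates $[x_0:x_1:x_2:x_3]$ of $\mathbb{P}^3$ given in the context, $W(\tau)$ is generated by the linear transformations $r_1$, $r_3$ and $\tau$, defined by the matrices $$R_1=\begin{pmatrix}0&1&0&0\\1&0&0&0\\0&0&0&1\\0&0&1&0\end{pmatrix},\quad R_3=\begin{pmatrix}0&0&1&0\\0&0&0&1\\1&0&0&0\\0&1&0&0\end{pmatrix},\quad T=\begin{pmatrix}1&0&0&0\\0&0&1&0\\0&1&0&0\\0&0&0&1\end{pmatrix},$$ and by the quadratic Cremona transformation $r_2:\mathbb{P}^3\dashrightarrow\mathbb{P}^3$ given by $$r_2([x_0:x_1:x_2:x_3])=[(x_1-x_0)(x_2-x_0):x_1(x_2-x_0):x_2(x_1-x_0):x_1x_2-x_0x_3].$$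
   Context: We work over $\mathbb{C}$. Let $G=\mathrm{PGL}(4)$, $H\subset B\subset G$ the subgroups of classes of diagonal and upper triangular matrices, $F=G/B$. The Weyl group $W=S_4$ (permutations of $\{0,1,2,3\}$) is identified with the classes of permutation matrices; $r_i$ is the transposition $(i-1,i)$, $i=1,2,3$. The anti-transposition $\tau$ is the involutive automorphism of $G$ sending the class of $A$ to the class of $w_0(A^{\top})^{-1}w_0$, where $w_0$ is the permutation matrix of $i\mapsto 3-i$; it preserves $B$ and $H$, satisfies $\tau r_i\tau=r_{4-i}$, and together with $W$ generates $W\rtimes\mathbb{Z}/2\mathbb{Z}$. This group acts on $F$ (with $\tau(gB)=\tau(g)B$) mapping $H$-orbits to $H$-orbits, hence acts birationally on the space of general $H$-orbits of $F$. A general $H$-orbit of $F$ has a unique representative of the form $e^YB$ with $$Y=\begin{pmatrix} 0 & 0 & 0 & 0 \\ 1 & 0 & 0 & 0 \\ {y_1} & 1 & 0 & 0 \\ {y_3} & {y_2} & 1 & 0 \end{pmatrix},$$ and is identified with the point $[y_0:y_1:y_2:y_3]=[1:y_1:y_2:y_3]\in\mathbb{P}^3$. This makes $\mathbb{P}^3$ a birational model of the space of general $H$-orbits, and yields the homomorphism $W\rtimes\mathbb{Z}/2\mathbb{Z}\to\mathrm{Bir}(\mathbb{P}^3)$. Explicitly, the image of $r_i$ sends $[1:y_1:y_2:y_3]$ to $[1:f_1:f_2:f_3]$, where one takes the LU-decomposition of $r_ie^Y$ (resp. of $w_0((e^Y)^{\top})^{-1}w_0$ for $\tau$), the logarithm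 of its lower unipotent factor, and conjugates it by a diagonal matrix so that all its subdiagonal entries are $1$; the $f_i$ are then the entries in the positions of the $y_i$. The coordinates $x_i$ are $$x_0=6y_0,\quad x_1=3y_0-6y_1,\quad x_2=3y_0+6y_2,\quad x_3=2y_0-3y_1+3y_2-6y_3.$$ *)

theory Defs
  imports
    "HOL-Analysis.Analysis"
    "HOL-Algebra.Generated_Groups"
    "HOL-Algebra.Left_Coset"
begin

text \<open>
  The index set \<open>{0,1,2,3}\<close> is the numeral type \<open>4\<close>: its elements are \<open>0,1,2,3\<close>, with the
  usual linear order, while arithmetic is modulo 4. The library function \<open>vector\<close> starts
  counting at index \<open>1\<close> and would put its last entry at index \<open>4 = 0\<close>; the two
  functions below list the entries in the order \<open>0,1,2,3\<close>.
\<close>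

definition vec4 :: "'a \<Rightarrow> 'a \<Rightarrow> 'a \<Rightarrow> 'a \<Rightarrow> 'a ^ 4"
  where "vec4 a b c d = (\<chi> i. if i = 0 then a else if i = 1 then b else if i = 2 then c else d)"

definition mat4 :: "'a \<times> 'a \<times> 'a \<times> 'a \<Rightarrow> 'a \<times> 'a \<times> 'a \<times> 'a \<Rightarrow>
    'a \<times> 'a \<times> 'a \<times> 'a \<Rightarrow> 'a \<times> 'a \<times> 'a \<times> 'a \<Rightarrow> 'a ^ 4 ^ 4"
  where "mat4 p q r s = (let row = (\<lambda>(a, b, c, d). vec4 a b c d)
    in vec4 (row p) (row q) (row r) (row s))"


section \<open>The group of birational self-maps of projective space\<close>

text \<open>
  Homogeneous polynomials of degree \<open>d\<close>, as polynomial functions (over the infinite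
  field of complex numbers nothing is lost). The zero polynomial has every degree.
\<close>

inductive homogeneous_poly :: "nat \<Rightarrow> (complex ^ 'n \<Rightarrow> complex) \<Rightarrow> bool"
  where
    const: "homogeneous_poly 0 (\<lambda>v. c)"
  | coord: "homogeneous_poly 1 (\<lambda>v. v $ i)"
  | add: "homogeneous_poly d p \<Longrightarrow> homogeneous_poly d q \<Longrightarrow> homogeneous_poly d (\<lambda>v. p v + q v)"
  | mult: "homogeneous_poly d p \<Longrightarrow> homogeneous_poly e q \<Longrightarrow>
      homogeneous_poly (d + e) (\<lambda>v. p v * q v)"

text \<open>
  A property of \<open>[v]\<close> holds for general points of projective space if it holds on a
  nonempty Zariski-open subset.
\<close>

definition generic :: "(complex ^ 'n \<Rightarrow> bool) \<Rightarrow> bool"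
  where "generic P \<longleftrightarrow> (\<exists>d q. homogeneous_poly d q \<and> (\<exists>v. q v \<noteq> 0) \<and>
    (\<forall>v. v \<noteq> 0 \<and> q v \<noteq> 0 \<longrightarrow> P v))"

text \<open>
  A rational self-map of projective space is represented by a nonzero tuple of
  homogeneous polynomials of the same degree; two tuples represent the same rational map
  iff they are proportional over the field of rational functions.
\<close>

definition rat_rep :: "(complex ^ 'n \<Rightarrow> complex ^ 'n) \<Rightarrow> bool"
  where "rat_rep f \<longleftrightarrow> (\<exists>d. \<forall>i. homogeneous_poly d (\<lambda>v. f v $ i)) \<and> (\<exists>v. f v \<noteq> 0)"

definition rat_rel :: "((complex ^ 'n \<Rightarrow> complex ^ 'n) \<times> (complex ^ 'n \<Rightarrow> complex ^ 'n)) set"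
  where "rat_rel = {(f, g). rat_rep f \<and> rat_rep g \<and>
    (\<forall>v i j. f v $ i * g v $ j = f v $ j * g v $ i)}"

definition rat_map :: "(complex ^ 'n \<Rightarrow> complex ^ 'n) \<Rightarrow> (complex ^ 'n \<Rightarrow> complex ^ 'n) set"
  where "rat_map f = rat_rel `` {f}"

definition Bir :: "((complex ^ 'n \<Rightarrow> complex ^ 'n) set) monoid"
  where "Bir = \<lparr>
    carrier = {rat_map f | f. rat_rep f \<and>
      (\<exists>g. rat_rep g \<and> (f \<circ> g, id) \<in> rat_rel \<and> (g \<circ> f, id) \<in> rat_rel)},
    mult = (\<lambda>\<Phi> \<Psi>. \<Union>f\<in>\<Phi>. \<Union>g\<in>\<Psi>. rat_map (f \<circ> g)),
    one = rat_map id\<rparr>"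

definition linear_map :: "complex ^ 'n ^ 'n \<Rightarrow> (complex ^ 'n \<Rightarrow> complex ^ 'n) set"
  where "linear_map M = rat_map (\<lambda>v. M *v v)"


section \<open>The group \<open>PGL(4)\<close>, its flag variety and the extended Weyl group\<close>

definition GL4 :: "(complex ^ 4 ^ 4) monoid"
  where "GL4 = \<lparr>carrier = {A. invertible A}, mult = (**), one = mat 1\<rparr>"

definition scalars :: "(complex ^ 4 ^ 4) set"
  where "scalars = {mat c | c. c \<noteq> 0}"

definition PGL4 :: "(complex ^ 4 ^ 4) set monoid"
  where "PGL4 = GL4 Mod scalars"

definition cls :: "complex ^ 4 ^ 4 \<Rightarrow> (complex ^ 4 ^ 4) set"
  where "cls A = scalars #>\<^bsub>GL4\<^esub> A"

definition torus :: "(complex ^ 4 ^ 4) set set"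
  where "torus = cls ` {A. invertible A \<and> (\<forall>i j. i \<noteq> j \<longrightarrow> A $ i $ j = 0)}"

definition borel_subgroup :: "(complex ^ 4 ^ 4) set set"
  where "borel_subgroup = cls ` {A. invertible A \<and> (\<forall>i j. j < i \<longrightarrow> A $ i $ j = 0)}"

text \<open>
  Points of \<open>F = G/B\<close> are the cosets \<open>gB\<close>, i.e. the elements of
  \<open>lcosets\<^bsub>PGL4\<^esub> borel_subgroup\<close>.
\<close>

type_synonym flag = "(complex ^ 4 ^ 4) set set"

definition flag_of :: "complex ^ 4 ^ 4 \<Rightarrow> flag"
  where "flag_of A = cls A <#\<^bsub>PGL4\<^esub> borel_subgroup"

definition torus_orbit :: "flag \<Rightarrow> flag set"
  where "torus_orbit X = {h <#\<^bsub>PGL4\<^esub> X | h. h \<in> torus}"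

definition perm_matrix :: "(4 \<Rightarrow> 4) \<Rightarrow> complex ^ 4 ^ 4"
  where "perm_matrix w = (\<chi> i j. if i = w j then 1 else 0)"

definition w0 :: "4 \<Rightarrow> 4"
  where "w0 i = 3 - i"

text \<open>
  The anti-transposition as an automorphism of \<open>PGL(4)\<close>: the image of the class of \<open>A\<close>,
  a set of proportional matrices, is taken elementwise. Likewise
  \<open>\<tau>(gB) = \<tau>(g)B\<close> is the elementwise image of the coset \<open>gB\<close>, because \<open>\<tau>(B) = B\<close>.
\<close>

definition anti_transposition :: "(complex ^ 4 ^ 4) set \<Rightarrow> (complex ^ 4 ^ 4) set"
  where "anti_transposition C =
    (\<lambda>A. perm_matrix w0 ** matrix_inv (transpose A) ** perm_matrix w0) ` C"

text \<open>
  \<open>W \<rtimes> \<int>/2\<int>\<close>: the pair \<open>(w, e)\<close> stands for \<open>w \<tau>\<^sup>e\<close>, and \<open>\<tau> w \<tau> = w\<^sub>0 w w\<^sub>0\<close>.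
\<close>

definition ext_weyl :: "((4 \<Rightarrow> 4) \<times> bool) monoid"
  where "ext_weyl = \<lparr>
    carrier = {w. w permutes UNIV} \<times> UNIV,
    mult = (\<lambda>(w, e) (w', e'). (w \<circ> (if e then w0 \<circ> w' \<circ> w0 else w'), e \<noteq> e')),
    one = (id, False)\<rparr>"

definition simple_reflection :: "4 \<Rightarrow> (4 \<Rightarrow> 4) \<times> bool"
  where "simple_reflection i = (Transposition.transpose (i - 1) i, False)"

definition tau :: "(4 \<Rightarrow> 4) \<times> bool"
  where "tau = (id, True)"

definition act :: "(4 \<Rightarrow> 4) \<times> bool \<Rightarrow> flag \<Rightarrow> flag"
  where "act = (\<lambda>(w, e) X. cls (perm_matrix w) <#\<^bsub>PGL4\<^esub> (if e then anti_transposition ` X else X))"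


section \<open>The tile group\<close>

definition mat_exp :: "complex ^ 'n ^ 'n \<Rightarrow> complex ^ 'n ^ 'n"
  where "mat_exp A = (\<Sum>k. (1 / fact k) *\<^sub>R (((\<lambda>M. A ** M) ^^ k) (mat 1)))"

text \<open>
  The orbit identified with the point \<open>[y\<^sub>0:y\<^sub>1:y\<^sub>2:y\<^sub>3] = [1:y\<^sub>1/y\<^sub>0:y\<^sub>2/y\<^sub>0:y\<^sub>3/y\<^sub>0]\<close>, where \<open>y\<^sub>0 \<noteq> 0\<close>.
\<close>

definition Y_matrix :: "complex ^ 4 \<Rightarrow> complex ^ 4 ^ 4"
  where "Y_matrix y = mat4
    (0, 0, 0, 0)
    (1, 0, 0, 0)
    (y $ 1 / y $ 0, 1, 0, 0)
    (y $ 3 / y $ 0, y $ 2 / y $ 0, 1, 0)"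

definition orbit_at :: "complex ^ 4 \<Rightarrow> flag set"
  where "orbit_at y = torus_orbit (flag_of (mat_exp (Y_matrix y)))"

text \<open>
  The action of \<open>g\<close> on the space of general \<open>H\<close>-orbits, read in its birational model \<open>\<P>\<^sup>3\<close>
  with coordinates \<open>y\<close>: \<open>g\<close> maps the orbit of a general point \<open>y\<close> onto the orbit of \<open>f(y)\<close>.
\<close>

definition induces :: "(4 \<Rightarrow> 4) \<times> bool \<Rightarrow> (complex ^ 4 \<Rightarrow> complex ^ 4) set \<Rightarrow> bool"
  where "induces g \<Phi> \<longleftrightarrow> (\<exists>f\<in>\<Phi>. generic (\<lambda>y. y $ 0 \<noteq> 0 \<and> f y $ 0 \<noteq> 0 \<and>
    act g ` orbit_at y = orbit_at (f y)))"

text \<open>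
  The map induced by \<open>g\<close> is unique because points \<open>y\<close> with distinct ratios
  \<open>y\<^sub>i/y\<^sub>0\<close> have distinct orbits.
\<close>

definition tile_hom :: "(4 \<Rightarrow> 4) \<times> bool \<Rightarrow> (complex ^ 4 \<Rightarrow> complex ^ 4) set"
  where "tile_hom g = (THE \<Phi>. \<Phi> \<in> carrier Bir \<and> induces g \<Phi>)"

definition tile_group :: "(complex ^ 4 \<Rightarrow> complex ^ 4) set set"
  where "tile_group = tile_hom ` carrier ext_weyl"

text \<open>
  The coordinates \<open>x\<close> are \<open>x = x_coords *v y\<close>; \<open>in_x_coords \<Phi>\<close> is the expression in the
  coordinates \<open>x\<close> of the birational map given by \<open>\<Phi>\<close> in the coordinates \<open>y\<close>.
\<close>

definition x_coords :: "complex ^ 4 ^ 4"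
  where "x_coords = mat4
    (6, 0, 0, 0)
    (3, -6, 0, 0)
    (3, 0, 6, 0)
    (2, -3, 3, -6)"

definition in_x_coords :: "(complex ^ 4 \<Rightarrow> complex ^ 4) set \<Rightarrow> (complex ^ 4 \<Rightarrow> complex ^ 4) set"
  where "in_x_coords \<Phi> = linear_map x_coords \<otimes>\<^bsub>Bir\<^esub> \<Phi> \<otimes>\<^bsub>Bir\<^esub> inv\<^bsub>Bir\<^esub> (linear_map x_coords)"

definition R1 :: "complex ^ 4 ^ 4"
  where "R1 = mat4 (0, 1, 0, 0) (1, 0, 0, 0) (0, 0, 0, 1) (0, 0, 1, 0)"

definition R3 :: "complex ^ 4 ^ 4"
  where "R3 = mat4 (0, 0, 1, 0) (0, 0, 0, 1) (1, 0, 0, 0) (0, 1, 0, 0)"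

definition T :: "complex ^ 4 ^ 4"
  where "T = mat4 (1, 0, 0, 0) (0, 0, 1, 0) (0, 1, 0, 0) (0, 0, 0, 1)"

end

theory Submission
  imports Defs
begin

text \<open>
  Write \<open>e\<^sup>Y\<close> as the lower unipotent matrix with subdiagonal entries \<open>1\<close> and entries \<open>a\<close>, \<open>b\<close>, \<open>c\<close>
  in the positions of \<open>y\<^sub>1\<close>, \<open>y\<^sub>2\<close>, \<open>y\<^sub>3\<close>. The coordinates \<open>x\<close> are the ones for which
  \<open>[x\<^sub>0 : x\<^sub>1 : x\<^sub>2 : x\<^sub>3] = [1 : 1 - a : b : b - c]\<close>, so the logarithm never has to be computed: the
  action of \<open>g\<close> is read off from the LU-decomposition \<open>g e\<^sup>Y U = D e\<^bsup>Y'\<^esup>\<close> with \<open>U\<close> upper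
  triangular and \<open>D\<close> diagonal. Explicit choices of \<open>U\<close> and \<open>D\<close> for the three simple reflections
  and for \<open>\<tau>\<close> give the formulas of the theorem (\<open>act_simple_reflection_1\<close> up to \<open>act_tau\<close>).

  For these computations to say something about the tile group, three facts are needed.
  First, torus orbits of flags are double cosets of matrices, on which the extended Weyl group acts
  compatibly with its action on matrices (\<open>act_torus_orbit\<close>, \<open>act_matrix_mult\<close>). Second, a
  birational map inducing the action of \<open>g\<close> is unique, because distinct points have distinct
  orbits (\<open>orbit_at_eqD\<close>, by uniqueness of LU-decompositions) and because homogeneous
  polynomials that vanish at general points vanish identically (\<open>generic_zero_imp_zero\<close>). Third,
  maps inducing \<open>g\<close> and \<open>h\<close> compose to a map inducing \<open>g h\<close>, because birational maps are dominant
  (\<open>dominant_nonzero\<close>, \<open>induces_mult\<close>). So \<open>tile_hom\<close> is a homomorphism into the group \<open>Bir\<close>, and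
  its image is generated by the images of \<open>r\<^sub>1\<close>, \<open>r\<^sub>2\<close>, \<open>r\<^sub>3\<close> and \<open>\<tau>\<close>, which generate the extended
  Weyl group (\<open>ext_weyl_induct\<close>).
\<close>


section \<open>Homogeneous polynomials and general points\<close>

lemma homogeneous_poly_scale:
  assumes "homogeneous_poly d p"
  shows "p (c *s v) = c ^ d * p v"
  using assms by (induction) (auto simp: power_add algebra_simps)

lemma homogeneous_poly_zero: "homogeneous_poly d (\<lambda>v. 0)"
proof (induction d)
  case (Suc d)
  show ?case using homogeneous_poly.mult[OF homogeneous_poly.coord Suc] by simp
qed (rule homogeneous_poly.const)

lemma homogeneous_poly_cmult: "homogeneous_poly d p \<Longrightarrow> homogeneous_poly d (\<lambda>v. c * p v)"
  using homogeneous_poly.mult[OF homogeneous_poly.const] by fastforce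

lemma homogeneous_poly_diff:
  "homogeneous_poly d p \<Longrightarrow> homogeneous_poly d q \<Longrightarrow> homogeneous_poly d (\<lambda>v. p v - q v)"
  using homogeneous_poly.add[OF _ homogeneous_poly_cmult[of d q "-1"]] by simp

lemma homogeneous_poly_sum:
  "(\<And>i. i \<in> I \<Longrightarrow> homogeneous_poly d (p i)) \<Longrightarrow> homogeneous_poly d (\<lambda>v. \<Sum>i\<in>I. p i v)"
  by (induction I rule: infinite_finite_induct)
     (auto intro: homogeneous_poly_zero homogeneous_poly.add)

lemma homogeneous_poly_compose:
  assumes "homogeneous_poly d p" and g: "\<And>i. homogeneous_poly e (\<lambda>v. g v $ i)"
  shows "homogeneous_poly (d * e) (\<lambda>v. p (g v))"
  using assms(1)
proof induction
  case (mult d p e' q)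
  from homogeneous_poly.mult[OF mult.IH] show ?case by (simp add: algebra_simps)
qed (use g in \<open>auto intro: homogeneous_poly.intros\<close>)

text \<open>
  Restricting to a line reduces questions about several variables to the fact that a nonzero
  polynomial in one variable has only finitely many zeros.
\<close>

lemma homogeneous_poly_line:
  assumes "homogeneous_poly d p"
  shows "\<exists>P. \<forall>t. p (a + t *s b) = poly P t"
  using assms
proof induction
  case (const c)
  show ?case by (rule exI[of _ "[:c:]"]) simp
next
  case (coord i)
  show ?case by (rule exI[of _ "[:a $ i, b $ i:]"]) simp
next
  case (add d p q)
  then obtain P Q where "\<forall>t. p (a + t *s b) = poly P t" "\<forall>t. q (a + t *s b) = poly Q t" by blast
  then show ?case by (intro exI[of _ "P + Q"]) simp
next
  case (mult d p e q)
  then obtain P Q where "\<forall>t. p (a + t *s b) = poly P t" "\<forall>t. q (a + t *s b) = poly Q t" by blast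
  then show ?case by (intro exI[of _ "P * Q"]) simp
qed

text \<open>
  Projective space is irreducible: on the line joining a point where \<open>p\<close> does not vanish to one
  where \<open>q\<close> does not vanish, both are nonzero away from finitely many points.
\<close>

lemma homogeneous_poly_common_nonzero:
  assumes p: "homogeneous_poly d p" and q: "homogeneous_poly e q" and "p a \<noteq> 0" "q b \<noteq> 0"
  shows "\<exists>v. p v \<noteq> 0 \<and> q v \<noteq> 0"
proof -
  obtain P Q where P: "\<And>t. p (a + t *s (b - a)) = poly P t"
    and Q: "\<And>t. q (a + t *s (b - a)) = poly Q t"
    using homogeneous_poly_line[OF p] homogeneous_poly_line[OF q] by metis
  have "poly P 0 \<noteq> 0" "poly Q 1 \<noteq> 0"
    using P[of 0] Q[of 1] assms(3,4) by auto
  then have "P * Q \<noteq> 0" by auto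
  then have "finite {t. poly (P * Q) t = 0}" by (rule poly_roots_finite)
  then obtain t where "poly (P * Q) t \<noteq> 0"
    using ex_new_if_finite[OF infinite_UNIV_char_0] by blast
  then show ?thesis using P Q by (intro exI[of _ "a + t *s (b - a)"]) auto
qed

lemma generic_mono: "generic P \<Longrightarrow> (\<And>v. P v \<Longrightarrow> Q v) \<Longrightarrow> generic Q"
  unfolding generic_def by meson

lemma generic_conj:
  assumes "generic P" "generic Q"
  shows "generic (\<lambda>v. P v \<and> Q v)"
proof -
  obtain d p e q a b where p: "homogeneous_poly d p" "p a \<noteq> 0" "\<And>v. v \<noteq> 0 \<Longrightarrow> p v \<noteq> 0 \<Longrightarrow> P v"
    and q: "homogeneous_poly e q" "q b \<noteq> 0" "\<And>v. v \<noteq> 0 \<Longrightarrow> q v \<noteq> 0 \<Longrightarrow> Q v"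
    using assms unfolding generic_def by metis
  show ?thesis unfolding generic_def
    using homogeneous_poly.mult[OF p(1) q(1)] p(3) q(3)
      homogeneous_poly_common_nonzero[OF p(1) q(1) p(2) q(2)]
    by (intro exI[of _ "d + e"] exI[of _ "\<lambda>v. p v * q v"]) auto
qed

text \<open>A nonempty Zariski-open set is dense: no nonzero polynomial vanishes on it.\<close>

lemma generic_zero_imp_zero:
  assumes p: "homogeneous_poly d p" and "generic (\<lambda>v. p v = 0)"
  shows "p v = 0"
proof (rule ccontr)
  assume nz: "p v \<noteq> 0"
  obtain e q b where q: "homogeneous_poly e q" "q b \<noteq> 0" "\<And>v. v \<noteq> 0 \<Longrightarrow> q v \<noteq> 0 \<Longrightarrow> p v = 0"
    using assms(2) unfolding generic_def by metis
  obtain u where u: "p u \<noteq> 0" "q u \<noteq> 0"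
    using homogeneous_poly_common_nonzero[OF p q(1) nz q(2)] by blast
  \<comment> \<open>The point \<open>u\<close> might be the origin; a coordinate function moves it away.\<close>
  fix i
  have "(axis i 1 :: complex ^ 'a) $ i \<noteq> 0" by simp
  then obtain w where w: "p w * q w \<noteq> 0" "w $ i \<noteq> 0"
    using homogeneous_poly_common_nonzero[OF homogeneous_poly.mult[OF p q(1)]
        homogeneous_poly.coord, of u "axis i 1" i] u by auto
  then have "w \<noteq> 0" by auto
  then show False using q(3)[of w] w(1) by auto
qed


section \<open>The group of birational maps\<close>

definition birational :: "(complex ^ 'n \<Rightarrow> complex ^ 'n) \<Rightarrow> bool"
  where "birational f \<longleftrightarrow> rat_rep f \<and>
    (\<exists>g. rat_rep g \<and> (f \<circ> g, id) \<in> rat_rel \<and> (g \<circ> f, id) \<in> rat_rel)"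

lemma rat_repI:
  assumes "\<And>i. homogeneous_poly d (\<lambda>v. f v $ i)" "f v \<noteq> 0"
  shows "rat_rep f"
  using assms unfolding rat_rep_def by blast

lemma rat_rep_degree:
  assumes "rat_rep f"
  obtains d where "\<And>i. homogeneous_poly d (\<lambda>v. f v $ i)"
  using assms unfolding rat_rep_def by blast

lemma rat_rel_rat_rep: "(f, g) \<in> rat_rel \<Longrightarrow> rat_rep f" "(f, g) \<in> rat_rel \<Longrightarrow> rat_rep g"
  by (auto simp: rat_rel_def)

lemma rat_rel_proportional:
  assumes "(f, g) \<in> rat_rel" "g v \<noteq> 0"
  obtains c where "f v = c *s g v"
proof -
  obtain j where j: "g v $ j \<noteq> 0" using assms(2) by (auto simp: vec_eq_iff)
  have "f v $ i * g v $ j = f v $ j * g v $ i" for i using assms(1) by (auto simp: rat_rel_def)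
  then have "f v = (f v $ j / g v $ j) *s g v" using j by (simp add: vec_eq_iff field_simps)
  then show ?thesis by (rule that)
qed

lemma rat_rel_refl: "rat_rep f \<Longrightarrow> (f, f) \<in> rat_rel"
  by (auto simp: rat_rel_def)

lemma rat_rel_sym: "(f, g) \<in> rat_rel \<Longrightarrow> (g, f) \<in> rat_rel"
  unfolding rat_rel_def by (auto simp: mult.commute)

text \<open>
  Proportionality at general points suffices, since the \<open>2 \<times> 2\<close> minors of the two tuples are
  homogeneous polynomials and vanish identically once they vanish generically.
\<close>

lemma rat_rel_genericI:
  assumes "rat_rep f" "rat_rep g"
    and "generic (\<lambda>v. \<forall>i j. f v $ i * g v $ j = f v $ j * g v $ i)"
  shows "(f, g) \<in> rat_rel"
proof -
  obtain d e where d: "\<And>i. homogeneous_poly d (\<lambda>v. f v $ i)"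
    and e: "\<And>i. homogeneous_poly e (\<lambda>v. g v $ i)"
    using rat_rep_degree[OF assms(1)] rat_rep_degree[OF assms(2)] by metis
  have "f v $ i * g v $ j - f v $ j * g v $ i = 0" for v i j
    by (rule generic_zero_imp_zero[OF homogeneous_poly_diff[OF
        homogeneous_poly.mult[OF d e] homogeneous_poly.mult[OF d e]]])
       (rule generic_mono[OF assms(3)], simp)
  then show ?thesis using assms(1,2) by (simp add: rat_rel_def)
qed

lemma generic_nonzero:
  assumes "rat_rep f"
  shows "generic (\<lambda>v. f v \<noteq> 0)"
proof -
  obtain d where d: "\<And>i. homogeneous_poly d (\<lambda>v. f v $ i)" using rat_rep_degree[OF assms] by blast
  obtain v i where "f v $ i \<noteq> 0" using assms by (auto simp: rat_rep_def vec_eq_iff)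
  then show ?thesis unfolding generic_def using d[of i]
    by (intro exI[of _ d] exI[of _ "\<lambda>v. f v $ i"]) auto
qed

lemma rat_rel_trans:
  assumes "(f, g) \<in> rat_rel" "(g, h) \<in> rat_rel"
  shows "(f, h) \<in> rat_rel"
proof (rule rat_rel_genericI)
  show "rat_rep f" "rat_rep h" using assms rat_rel_rat_rep by blast+
  show "generic (\<lambda>v. \<forall>i j. f v $ i * h v $ j = f v $ j * h v $ i)"
  proof (rule generic_mono[OF generic_nonzero[OF rat_rel_rat_rep(2)[OF assms(1)]]], intro allI)
    fix v i j
    assume nz: "g v \<noteq> 0"
    obtain b where "f v = b *s g v" using rat_rel_proportional[OF assms(1) nz] .
    moreover obtain c where "h v = c *s g v"
      using rat_rel_proportional[OF rat_rel_sym[OF assms(2)] nz] .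
    ultimately show "f v $ i * h v $ j = f v $ j * h v $ i" by simp
  qed
qed

lemma rat_map_eq_iff:
  assumes "rat_rep f" "rat_rep g"
  shows "rat_map f = rat_map g \<longleftrightarrow> (f, g) \<in> rat_rel"
  unfolding rat_map_def
  using rat_rel_refl[OF assms(2)] rat_rel_sym rat_rel_trans by blast

lemma mem_rat_map: "f' \<in> rat_map f \<longleftrightarrow> (f, f') \<in> rat_rel"
  by (simp add: rat_map_def)

text \<open>
  A map with a right inverse \<open>g\<close> is dominant: \<open>f (g v)\<close> is generally a nonzero multiple of \<open>v\<close>,
  so by homogeneity \<open>q \<circ> f\<close> cannot vanish identically unless \<open>q\<close> does.
\<close>

lemma dominant_nonzero:
  assumes fg: "(f \<circ> g, id) \<in> rat_rel" and q: "homogeneous_poly d q" and "q a \<noteq> 0"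
  shows "\<exists>v. q (f v) \<noteq> 0"
proof -
  obtain e where e: "\<And>i. homogeneous_poly e (\<lambda>v. (f \<circ> g) v $ i)"
    using rat_rep_degree[OF rat_rel_rat_rep(1)[OF fg]] by blast
  obtain b i where b: "(f \<circ> g) b $ i \<noteq> 0"
    using rat_rel_rat_rep(1)[OF fg] by (auto simp: rat_rep_def vec_eq_iff)
  obtain v where v: "(f \<circ> g) v $ i \<noteq> 0" "q v \<noteq> 0"
    using homogeneous_poly_common_nonzero[OF e[of i] q, of b a] b assms(3) by blast
  show ?thesis
  proof (cases "v = 0")
    case True
    \<comment> \<open>Only constants do not vanish at the origin.\<close>
    have "q (0 *s u) = 0 ^ d * q u" for u :: "complex ^ 'a" by (rule homogeneous_poly_scale[OF q])
    then have "q v = q u * 0 ^ d" for u using True by (simp add: mult.commute)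
    then show ?thesis using v(2) by (metis mult_zero_left)
  next
    case False
    then obtain c where c: "f (g v) = c *s v" using rat_rel_proportional[OF fg, of v] by auto
    have "c \<noteq> 0" using c v(1) by auto
    have "q (f (g v)) = c ^ d * q v" unfolding c by (rule homogeneous_poly_scale[OF q])
    then have "q (f (g v)) \<noteq> 0" using v(2) \<open>c \<noteq> 0\<close> by simp
    then show ?thesis by blast
  qed
qed

lemma rat_rep_comp:
  assumes f: "rat_rep f" and g: "rat_rep g" "(g \<circ> k, id) \<in> rat_rel"
  shows "rat_rep (f \<circ> g)"
proof -
  obtain d where d: "\<And>i. homogeneous_poly d (\<lambda>v. f v $ i)" using rat_rep_degree[OF f] by blast
  obtain e where e: "\<And>i. homogeneous_poly e (\<lambda>v. g v $ i)" using rat_rep_degree[OF g(1)] by blast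
  obtain a i where "f a $ i \<noteq> 0" using f by (auto simp: rat_rep_def vec_eq_iff)
  then obtain v where "f (g v) $ i \<noteq> 0" using dominant_nonzero[OF g(2) d[of i]] by blast
  then have "(f \<circ> g) v \<noteq> 0" by auto
  then show ?thesis
    using homogeneous_poly_compose[OF d e] by (intro rat_repI[of "d * e"]) auto
qed

text \<open>
  The composite of two rational maps, computed from representatives, might vanish identically;
  this is why nonvanishing is a separate hypothesis of the two congruence rules. It is
  guaranteed when the inner map is birational, hence dominant.
\<close>

lemma rat_rel_comp_left:
  assumes "(f, f') \<in> rat_rel" "rat_rep (f \<circ> g)" "rat_rep (f' \<circ> g)"
  shows "(f \<circ> g, f' \<circ> g) \<in> rat_rel"
  using assms by (auto simp: rat_rel_def)

lemma rat_rel_comp_right: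
  assumes f: "rat_rep f" and g: "(g, g') \<in> rat_rel"
    and "rat_rep (f \<circ> g)" "rat_rep (f \<circ> g')"
  shows "(f \<circ> g, f \<circ> g') \<in> rat_rel"
proof (rule rat_rel_genericI[OF assms(3,4)])
  obtain d where d: "\<And>i. homogeneous_poly d (\<lambda>v. f v $ i)" using rat_rep_degree[OF f] by blast
  show "generic (\<lambda>v. \<forall>i j. (f \<circ> g) v $ i * (f \<circ> g') v $ j = (f \<circ> g) v $ j * (f \<circ> g') v $ i)"
  proof (rule generic_mono[OF generic_nonzero[OF rat_rel_rat_rep(2)[OF g]]], intro allI)
    fix v i j
    assume "g' v \<noteq> 0"
    then obtain c where c: "g v = c *s g' v" using rat_rel_proportional[OF g] by blast
    show "(f \<circ> g) v $ i * (f \<circ> g') v $ j = (f \<circ> g) v $ j * (f \<circ> g') v $ i"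
      by (simp add: c homogeneous_poly_scale[OF d])
  qed
qed

lemma rat_rep_id: "rat_rep (id :: complex ^ 'n \<Rightarrow> complex ^ 'n)"
proof (rule rat_repI)
  show "id (axis undefined 1 :: complex ^ 'n) \<noteq> 0" by (simp add: axis_eq_0_iff)
  show "homogeneous_poly 1 (\<lambda>v. id (v :: complex ^ 'n) $ i)" for i
    by (simp add: homogeneous_poly.coord[unfolded One_nat_def])
qed

lemma birational_id: "birational id"
  unfolding birational_def using rat_rep_id rat_rel_refl[OF rat_rep_id] by auto

lemma birational_rat_rep: "birational f \<Longrightarrow> rat_rep f"
  by (simp add: birational_def)

lemma birational_inverse:
  assumes "birational f"
  obtains g where "birational g" "(f \<circ> g, id) \<in> rat_rel" "(g \<circ> f, id) \<in> rat_rel"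
  using assms unfolding birational_def by blast

lemma rat_rep_comp_birational: "rat_rep f \<Longrightarrow> birational g \<Longrightarrow> rat_rep (f \<circ> g)"
  using rat_rep_comp unfolding birational_def by blast

lemma birational_involution:
  assumes "rat_rep f" "(f \<circ> f, id) \<in> rat_rel"
  shows "birational f"
  using assms unfolding birational_def by blast

lemma birational_comp:
  assumes "birational f" "birational g"
  shows "birational (f \<circ> g)"
proof -
  obtain f' where f': "birational f'" "(f \<circ> f', id) \<in> rat_rel" "(f' \<circ> f, id) \<in> rat_rel"
    using birational_inverse[OF assms(1)] .
  obtain g' where g': "birational g'" "(g \<circ> g', id) \<in> rat_rel" "(g' \<circ> g, id) \<in> rat_rel"
    using birational_inverse[OF assms(2)] .
  note rep = assms[THEN birational_rat_rep] f'(1)[THEN birational_rat_rep]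
    g'(1)[THEN birational_rat_rep]
  note comp = rat_rep_comp_birational
  have "((f \<circ> g) \<circ> (g' \<circ> f'), f \<circ> f') \<in> rat_rel"
  proof -
    have "((g \<circ> g') \<circ> f', id \<circ> f') \<in> rat_rel"
      using g' f'(1) rep by (intro rat_rel_comp_left) (auto intro!: comp simp: assms)
    moreover have "rat_rep (f \<circ> (g \<circ> g' \<circ> f'))"
      using comp[OF comp[OF comp[OF rep(1) assms(2)] g'(1)] f'(1)] by (simp add: comp_assoc)
    ultimately have "(f \<circ> ((g \<circ> g') \<circ> f'), f \<circ> (id \<circ> f')) \<in> rat_rel"
      using rep f'(1) by (intro rat_rel_comp_right) (auto intro!: comp simp: assms)
    then show ?thesis by (simp add: comp_assoc)
  qed
  moreover have "((g' \<circ> f') \<circ> (f \<circ> g), g' \<circ> g) \<in> rat_rel"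
  proof -
    have "((f' \<circ> f) \<circ> g, id \<circ> g) \<in> rat_rel"
      using f' assms rep by (intro rat_rel_comp_left) (auto intro!: comp simp: assms)
    moreover have "rat_rep (g' \<circ> (f' \<circ> f \<circ> g))"
      using comp[OF comp[OF comp[OF rep(4) f'(1)] assms(1)] assms(2)] by (simp add: comp_assoc)
    ultimately have "(g' \<circ> ((f' \<circ> f) \<circ> g), g' \<circ> (id \<circ> g)) \<in> rat_rel"
      using rep assms(2) by (intro rat_rel_comp_right) (auto intro!: comp simp: assms)
    then show ?thesis by (simp add: comp_assoc)
  qed
  ultimately show ?thesis unfolding birational_def
    using comp[OF rep(1) assms(2)] comp[OF rep(4) f'(1)] f'(2) g'(3) rat_rel_trans by blast
qed

lemma birational_cong:
  assumes "birational f" "(f, f') \<in> rat_rel"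
  shows "birational f'"
proof -
  obtain g where g: "birational g" "(f \<circ> g, id) \<in> rat_rel" "(g \<circ> f, id) \<in> rat_rel"
    using birational_inverse[OF assms(1)] .
  have rep: "rat_rep f" "rat_rep f'" "rat_rep g"
    using assms rat_rel_rat_rep g(1) birational_rat_rep by blast+
  have "(f' \<circ> g, f \<circ> g) \<in> rat_rel"
    using g(1) rep by (intro rat_rel_comp_left rat_rel_sym[OF assms(2)] rat_rep_comp_birational)
  then have r: "(f' \<circ> g, id) \<in> rat_rel" using g(2) rat_rel_trans by blast
  have "(g \<circ> f', g \<circ> f) \<in> rat_rel"
    using rep assms(1) r
    by (intro rat_rel_comp_right rat_rel_sym[OF assms(2)]) (auto intro: rat_rep_comp rat_rep_comp_birational)
  then have "(g \<circ> f', id) \<in> rat_rel" using g(3) rat_rel_trans by blast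
  then show ?thesis using r rep unfolding birational_def by blast
qed

lemma carrier_Bir: "carrier Bir = {rat_map f | f. birational f}"
  by (simp add: Bir_def birational_def)

lemma rat_map_in_Bir: "birational f \<Longrightarrow> rat_map f \<in> carrier Bir"
  by (auto simp: carrier_Bir)

lemma Bir_one: "\<one>\<^bsub>Bir\<^esub> = rat_map id"
  by (simp add: Bir_def)

text \<open>
  The product in \<open>Bir\<close> is a union over all representatives, which collapses to one class because
  all the composites are proportional.
\<close>

lemma Bir_mult:
  assumes "birational f" "birational g"
  shows "rat_map f \<otimes>\<^bsub>Bir\<^esub> rat_map g = rat_map (f \<circ> g)"
proof -
  have eq: "rat_map (f' \<circ> g') = rat_map (f \<circ> g)" if "f' \<in> rat_map f" "g' \<in> rat_map g" for f' g'
  proof -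
    have ff: "(f', f) \<in> rat_rel" and gg: "(g', g) \<in> rat_rel"
      using that by (auto simp: mem_rat_map intro: rat_rel_sym)
    have bir: "birational f'" "birational g'"
      using birational_cong assms that by (auto simp: mem_rat_map)
    note rep = rat_rep_comp_birational birational_rat_rep
    have "(f' \<circ> g', f \<circ> g') \<in> rat_rel"
      using bir assms by (intro rat_rel_comp_left ff rep)
    moreover have "(f \<circ> g', f \<circ> g) \<in> rat_rel"
      using bir assms by (intro rat_rel_comp_right gg rep)
    ultimately show ?thesis
      using bir assms rat_rel_trans by (subst rat_map_eq_iff) (auto intro: rep)
  qed
  have "f \<in> rat_map f" "g \<in> rat_map g"
    using assms by (auto simp: mem_rat_map intro: rat_rel_refl birational_rat_rep)
  then have "(\<Union>f'\<in>rat_map f. \<Union>g'\<in>rat_map g. rat_map (f' \<circ> g')) = rat_map (f \<circ> g)"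
    using eq by blast
  then show ?thesis by (simp add: Bir_def)
qed

lemma group_Bir: "group Bir"
proof (rule groupI)
  show "x \<otimes>\<^bsub>Bir\<^esub> y \<in> carrier Bir" if "x \<in> carrier Bir" "y \<in> carrier Bir"
    for x y :: "(complex ^ 'a \<Rightarrow> complex ^ 'a) set"
    using that by (auto simp: carrier_Bir Bir_mult intro: birational_comp)
  show "\<one>\<^bsub>Bir\<^esub> \<in> carrier Bir" by (simp add: Bir_one rat_map_in_Bir birational_id)
  show "x \<otimes>\<^bsub>Bir\<^esub> y \<otimes>\<^bsub>Bir\<^esub> z = x \<otimes>\<^bsub>Bir\<^esub> (y \<otimes>\<^bsub>Bir\<^esub> z)"
    if "x \<in> carrier Bir" "y \<in> carrier Bir" "z \<in> carrier Bir"
    for x y z :: "(complex ^ 'a \<Rightarrow> complex ^ 'a) set"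
    using that by (auto simp: carrier_Bir Bir_mult birational_comp comp_assoc)
  show "\<one>\<^bsub>Bir\<^esub> \<otimes>\<^bsub>Bir\<^esub> x = x" if "x \<in> carrier Bir"
    for x :: "(complex ^ 'a \<Rightarrow> complex ^ 'a) set"
    using that by (auto simp: carrier_Bir Bir_one Bir_mult birational_id)
  show "\<exists>y\<in>carrier Bir. y \<otimes>\<^bsub>Bir\<^esub> x = \<one>\<^bsub>Bir\<^esub>" if x: "x \<in> carrier Bir"
    for x :: "(complex ^ 'a \<Rightarrow> complex ^ 'a) set"
  proof -
    obtain f where f: "x = rat_map f" "birational f" using x by (auto simp: carrier_Bir)
    obtain g where g: "birational g" "(f \<circ> g, id) \<in> rat_rel" "(g \<circ> f, id) \<in> rat_rel"
      using birational_inverse[OF f(2)] .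
    then have "rat_map g \<otimes>\<^bsub>Bir\<^esub> x = \<one>\<^bsub>Bir\<^esub>"
      using f by (simp add: Bir_mult Bir_one rat_map_eq_iff rat_rel_rat_rep)
    then show ?thesis using g(1) rat_map_in_Bir by blast
  qed
qed

lemma linear_map_rat_rep:
  fixes A B :: "complex ^ 'n ^ 'n"
  assumes "A ** B = mat 1"
  shows "rat_rep (\<lambda>v. A *v v)"
proof -
  define w where "w = (axis undefined 1 :: complex ^ 'n)"
  have "homogeneous_poly (0 + 1) (\<lambda>v. A $ i $ j * v $ j)" for i j
    by (rule homogeneous_poly.mult[OF homogeneous_poly.const homogeneous_poly.coord])
  then have h: "homogeneous_poly 1 (\<lambda>v. (A *v v) $ i)" for i
    by (auto simp: matrix_vector_mult_def intro!: homogeneous_poly_sum)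
  have "A *v (B *v w) = w" using assms by (simp add: matrix_vector_mul_assoc)
  moreover have "w \<noteq> 0" by (simp add: w_def axis_eq_0_iff)
  ultimately show ?thesis using h by (intro rat_repI[of 1 _ "B *v w"]) auto
qed

lemma birational_linear_map:
  fixes A B :: "complex ^ 'n ^ 'n"
  assumes "A ** B = mat 1"
  shows "birational (\<lambda>v. A *v v)"
proof -
  have BA: "B ** A = mat 1" using assms matrix_left_right_inverse by blast
  have "(\<lambda>v. A *v v) \<circ> (\<lambda>v. B *v v) = id" "(\<lambda>v. B *v v) \<circ> (\<lambda>v. A *v v) = id"
    using assms BA by (auto simp: matrix_vector_mul_assoc fun_eq_iff)
  then show ?thesis unfolding birational_def
    using linear_map_rat_rep[OF assms] linear_map_rat_rep[OF BA] rat_rel_refl[OF rat_rep_id] by metis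
qed


section \<open>Matrices of size four\<close>

lemma UNIV_4_from_0: "(UNIV :: 4 set) = {0, 1, 2, 3}"
proof -
  have "(4::4) = 0" by simp
  then show ?thesis unfolding UNIV_4 by (simp only: insert_commute)
qed

lemma all_4_from_0: "(\<forall>i::4. P i) \<longleftrightarrow> P 0 \<and> P 1 \<and> P 2 \<and> P 3"
  using UNIV_4_from_0 by (metis UNIV_I empty_iff insert_iff)

lemma sum_4_from_0: "sum f (UNIV :: 4 set) = f 0 + f 1 + f 2 + f 3"
  unfolding UNIV_4_from_0 by (simp add: add.assoc)

lemma less_4 [simp]:
  "\<not> ((0::4) < 0)" "((0::4) < 1)" "((0::4) < 2)" "((0::4) < 3)"
  "\<not> ((1::4) < 0)" "\<not> ((1::4) < 1)" "((1::4) < 2)" "((1::4) < 3)"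
  "\<not> ((2::4) < 0)" "\<not> ((2::4) < 1)" "\<not> ((2::4) < 2)" "((2::4) < 3)"
  "\<not> ((3::4) < 0)" "\<not> ((3::4) < 1)" "\<not> ((3::4) < 2)" "\<not> ((3::4) < 3)"
  by (simp_all add: less_bit0_def bit0.Rep_numeral bit0.Rep_1 bit0.Rep_0)

lemma vec4_nth [simp]:
  "vec4 a b c d $ 0 = a" "vec4 a b c d $ 1 = b" "vec4 a b c d $ 2 = c" "vec4 a b c d $ 3 = d"
  by (simp_all add: vec4_def)

lemma mat4_nth [simp]:
  "(mat4 (a, b, c, d) (e, f, g, h) (i, j, k, l) (m, n, p, q)) $ 0 $ 0 = a"
  "(mat4 (a, b, c, d) (e, f, g, h) (i, j, k, l) (m, n, p, q)) $ 0 $ 1 = b"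
  "(mat4 (a, b, c, d) (e, f, g, h) (i, j, k, l) (m, n, p, q)) $ 0 $ 2 = c"
  "(mat4 (a, b, c, d) (e, f, g, h) (i, j, k, l) (m, n, p, q)) $ 0 $ 3 = d"
  "(mat4 (a, b, c, d) (e, f, g, h) (i, j, k, l) (m, n, p, q)) $ 1 $ 0 = e"
  "(mat4 (a, b, c, d) (e, f, g, h) (i, j, k, l) (m, n, p, q)) $ 1 $ 1 = f"
  "(mat4 (a, b, c, d) (e, f, g, h) (i, j, k, l) (m, n, p, q)) $ 1 $ 2 = g"
  "(mat4 (a, b, c, d) (e, f, g, h) (i, j, k, l) (m, n, p, q)) $ 1 $ 3 = h"
  "(mat4 (a, b, c, d) (e, f, g, h) (i, j, k, l) (m, n, p, q)) $ 2 $ 0 = i"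
  "(mat4 (a, b, c, d) (e, f, g, h) (i, j, k, l) (m, n, p, q)) $ 2 $ 1 = j"
  "(mat4 (a, b, c, d) (e, f, g, h) (i, j, k, l) (m, n, p, q)) $ 2 $ 2 = k"
  "(mat4 (a, b, c, d) (e, f, g, h) (i, j, k, l) (m, n, p, q)) $ 2 $ 3 = l"
  "(mat4 (a, b, c, d) (e, f, g, h) (i, j, k, l) (m, n, p, q)) $ 3 $ 0 = m"
  "(mat4 (a, b, c, d) (e, f, g, h) (i, j, k, l) (m, n, p, q)) $ 3 $ 1 = n"
  "(mat4 (a, b, c, d) (e, f, g, h) (i, j, k, l) (m, n, p, q)) $ 3 $ 2 = p"
  "(mat4 (a, b, c, d) (e, f, g, h) (i, j, k, l) (m, n, p, q)) $ 3 $ 3 = q"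
  by (simp_all add: mat4_def)

lemmas matrix_4_simps = vec_eq_iff all_4_from_0 matrix_matrix_mult_def
  sum_4_from_0

lemma matrix_mul_cancel:
  fixes A B :: "complex ^ 'n ^ 'n"
  assumes "A ** B = mat 1"
  shows "A ** (B ** C) = C"
  using assms by (simp add: matrix_mul_assoc)

lemma matrix_inv_eqI:
  fixes A B :: "complex ^ 'n ^ 'n"
  assumes "A ** B = mat 1"
  shows "matrix_inv A = B"
proof -
  have "B ** A = mat 1" using assms matrix_left_right_inverse by blast
  have "A ** matrix_inv A = mat 1 \<and> matrix_inv A ** A = mat 1"
    unfolding matrix_inv_def by (rule someI[of _ B]) (use assms \<open>B ** A = mat 1\<close> in simp)
  then show ?thesis using \<open>B ** A = mat 1\<close>
    using matrix_mul_cancel[of B A "matrix_inv A"] by simp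
qed

lemma matrix_scalar_commute:
  fixes A :: "complex ^ 'n ^ 'n"
  shows "A ** mat c = mat c ** A"
  by (simp add: vec_eq_iff matrix_matrix_mult_def mat_def mult_delta_left mult_delta_right)

lemma invertible_left_cancel:
  fixes A B U :: "complex ^ 'n ^ 'n"
  assumes "A ** U = B" "invertible A" "invertible B"
  shows "invertible U"
proof -
  obtain C where C: "C ** A = mat 1" using assms(2) invertible_left_inverse by blast
  obtain D where D: "B ** D = mat 1" using assms(3) invertible_right_inverse by blast
  have "U = C ** B" using matrix_mul_cancel[OF C, of U] assms(1) by simp
  moreover have "invertible C" using C invertible_right_inverse by blast
  ultimately show ?thesis using assms(3) invertible_mult by blast
qed

lemma invertible_transpose:
  fixes A :: "complex ^ 'n ^ 'n"
  assumes "invertible A"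
  shows "invertible (transpose A)"
proof -
  obtain B where "B ** A = mat 1" using assms invertible_left_inverse by blast
  then have "transpose A ** transpose B = mat 1"
    by (simp add: matrix_transpose_mul[symmetric] transpose_mat)
  then show ?thesis using invertible_right_inverse by blast
qed

definition upper_matrices :: "(complex ^ 4 ^ 4) set"
  where "upper_matrices = {A. invertible A \<and> (\<forall>i j. j < i \<longrightarrow> A $ i $ j = 0)}"

definition diagonal_matrices :: "(complex ^ 4 ^ 4) set"
  where "diagonal_matrices = {A. invertible A \<and> (\<forall>i j. i \<noteq> j \<longrightarrow> A $ i $ j = 0)}"

lemma upper_matrices_invertible: "A \<in> upper_matrices \<Longrightarrow> invertible A"
  by (simp add: upper_matrices_def)

lemma diagonal_matrices_invertible: "A \<in> diagonal_matrices \<Longrightarrow> invertible A"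
  by (simp add: diagonal_matrices_def)

lemma invertible_mat_1: "invertible (mat 1 :: complex ^ 'n ^ 'n)"
  unfolding invertible_right_inverse by (rule exI[of _ "mat 1"]) simp

lemma mat_1_upper: "mat 1 \<in> upper_matrices"
  by (simp add: upper_matrices_def invertible_mat_1) (simp add: mat_def)

lemma mat_1_diagonal: "mat 1 \<in> diagonal_matrices"
  by (simp add: diagonal_matrices_def invertible_mat_1) (simp add: mat_def)

lemma upper_matrices_mult:
  assumes "A \<in> upper_matrices" "B \<in> upper_matrices"
  shows "A ** B \<in> upper_matrices"
proof -
  have "(A ** B) $ i $ j = 0" if "j < i" for i j
  proof -
    have "A $ i $ k * B $ k $ j = 0" for k
    proof (cases "k < i")
      case True
      then show ?thesis using assms(1) by (simp add: upper_matrices_def)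
    next
      case False
      then have "j < k" using that by simp
      then show ?thesis using assms(2) by (simp add: upper_matrices_def)
    qed
    then show ?thesis unfolding matrix_matrix_mult_def by (simp only: vec_lambda_beta sum.neutral_const)
  qed
  then show ?thesis using assms by (auto simp: upper_matrices_def invertible_mult)
qed

lemma upper_matrices_scalar:
  assumes "c \<noteq> 0" "A \<in> upper_matrices"
  shows "mat c ** A \<in> upper_matrices"
proof -
  have "mat c ** mat (1 / c) = (mat 1 :: complex ^ 4 ^ 4)"
    using assms(1) by (simp add: matrix_4_simps mat_def)
  then have "invertible (mat c :: complex ^ 4 ^ 4)" using invertible_right_inverse by blast
  then have "(mat c :: complex ^ 4 ^ 4) \<in> upper_matrices"
    by (simp add: upper_matrices_def) (simp add: mat_def)
  then show ?thesis using assms(2) upper_matrices_mult by blast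
qed

text \<open>
  In \<open>B A = 1\<close> with \<open>A\<close> upper triangular, the columns of \<open>B\<close> can be solved for one after the other,
  from the left.
\<close>

lemma upper_matrices_inverse:
  assumes A: "A \<in> upper_matrices" and AB: "A ** B = mat 1"
  shows "B \<in> upper_matrices"
proof -
  have BA: "B ** A = mat 1" using AB matrix_left_right_inverse by blast
  have A0: "A $ 1 $ 0 = 0" "A $ 2 $ 0 = 0" "A $ 3 $ 0 = 0" "A $ 2 $ 1 = 0" "A $ 3 $ 1 = 0" "A $ 3 $ 2 = 0"
    using A by (auto simp: upper_matrices_def)
  have entry: "B $ i $ 0 * A $ 0 $ j + B $ i $ 1 * A $ 1 $ j + B $ i $ 2 * A $ 2 $ j
      + B $ i $ 3 * A $ 3 $ j = (if i = j then 1 else 0)" for i j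
    using arg_cong[OF BA, of "\<lambda>M. M $ i $ j"]
    by (simp add: matrix_matrix_mult_def sum_4_from_0 mat_def)
  have "A $ 0 $ 0 \<noteq> 0" using entry[of 0 0] A0 by auto
  then have 0: "B $ 1 $ 0 = 0" "B $ 2 $ 0 = 0" "B $ 3 $ 0 = 0"
    using entry[of 1 0] entry[of 2 0] entry[of 3 0] A0 by auto
  then have "A $ 1 $ 1 \<noteq> 0" using entry[of 1 1] A0 by auto
  then have 1: "B $ 2 $ 1 = 0" "B $ 3 $ 1 = 0" using entry[of 2 1] entry[of 3 1] A0 0 by auto
  then have "A $ 2 $ 2 \<noteq> 0" using entry[of 2 2] A0 0 by auto
  then have 2: "B $ 3 $ 2 = 0" using entry[of 3 2] A0 0 1 by auto
  have "invertible B" using AB invertible_left_inverse by blast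
  then show ?thesis using 0 1 2 by (simp add: upper_matrices_def all_4_from_0)
qed

lemma diagonal_iff_upper:
  "A \<in> diagonal_matrices \<longleftrightarrow> A \<in> upper_matrices \<and> transpose A \<in> upper_matrices"
proof -
  have "(\<forall>i j. i \<noteq> j \<longrightarrow> A $ i $ j = 0) \<longleftrightarrow>
      (\<forall>i j. j < i \<longrightarrow> A $ i $ j = 0) \<and> (\<forall>i j. j < i \<longrightarrow> transpose A $ i $ j = 0)"
    by (auto simp: neq_iff transpose_def)
  then show ?thesis
    unfolding diagonal_matrices_def upper_matrices_def mem_Collect_eq
    using invertible_transpose[of A] invertible_transpose[of "transpose A"] by argo
qed

lemma diagonal_matrices_mult:
  assumes "A \<in> diagonal_matrices" "B \<in> diagonal_matrices"
  shows "A ** B \<in> diagonal_matrices"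
  using assms unfolding diagonal_iff_upper by (simp add: matrix_transpose_mul upper_matrices_mult)

lemma diagonal_matrices_inverse:
  assumes "A \<in> diagonal_matrices" and AB: "A ** B = mat 1"
  shows "B \<in> diagonal_matrices"
proof -
  have "transpose B ** transpose A = mat 1" 
    using AB by (simp add: matrix_transpose_mul[symmetric] transpose_mat)
  then have "transpose A ** transpose B = mat 1" using matrix_left_right_inverse by blast
  then show ?thesis using assms unfolding diagonal_iff_upper by (auto intro: upper_matrices_inverse)
qed

lemma mult_image_subgroup:
  fixes S :: "(complex ^ 'n ^ 'n) set"
  assumes "A \<in> S" "invertible A" "\<And>A B. A \<in> S \<Longrightarrow> B \<in> S \<Longrightarrow> A ** B \<in> S"
    "\<And>A B. A \<in> S \<Longrightarrow> A ** B = mat 1 \<Longrightarrow> B \<in> S"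
  shows "(\<lambda>B. A ** B) ` S = S" "(\<lambda>B. B ** A) ` S = S"
proof -
  obtain C where AC: "A ** C = mat 1" and CA: "C ** A = mat 1"
    using assms(2) unfolding invertible_def by blast
  have C: "C \<in> S" using assms AC by blast
  have "A ** (C ** B) = B" "(B ** C) ** A = B" for B
    using AC CA by (simp_all add: matrix_mul_cancel matrix_mul_assoc[symmetric])
  then have "B \<in> (\<lambda>B. A ** B) ` S" "B \<in> (\<lambda>B. B ** A) ` S" if "B \<in> S" for B
    using that assms(3) C by (metis image_eqI)+
  then show "(\<lambda>B. A ** B) ` S = S" "(\<lambda>B. B ** A) ` S = S"
    using assms(1,3) by blast+
qed

lemma upper_mult_image:
  assumes "A \<in> upper_matrices"
  shows "(\<lambda>B. A ** B) ` upper_matrices = upper_matrices"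
  by (rule mult_image_subgroup(1)[OF assms upper_matrices_invertible[OF assms]
        upper_matrices_mult upper_matrices_inverse])

lemma diagonal_mult_image:
  assumes "A \<in> diagonal_matrices"
  shows "(\<lambda>B. B ** A) ` diagonal_matrices = diagonal_matrices"
  by (rule mult_image_subgroup(2)[OF assms diagonal_matrices_invertible[OF assms]
        diagonal_matrices_mult diagonal_matrices_inverse])


section \<open>Permutation matrices and the anti-transposition\<close>

lemma perm_matrix_mult_left:
  assumes "w permutes UNIV"
  shows "(perm_matrix w ** M) $ i $ j = M $ (inv_into UNIV w i) $ j"
proof -
  have "i = w k \<longleftrightarrow> k = inv_into UNIV w i" for k
    using assms by (metis permutes_inverses(1) permutes_inverses(2))
  then show ?thesis
    by (simp add: matrix_matrix_mult_def perm_matrix_def mult_delta_left mult_delta_right)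
qed

lemma perm_matrix_mult_right: "(M ** perm_matrix w) $ i $ j = M $ i $ w j"
  by (simp add: matrix_matrix_mult_def perm_matrix_def mult_delta_left mult_delta_right)

lemma perm_matrix_mult: "perm_matrix w ** perm_matrix v = perm_matrix (w \<circ> v)"
  by (simp add: vec_eq_iff perm_matrix_mult_right) (simp add: perm_matrix_def)

lemma perm_matrix_id: "perm_matrix id = mat 1"
  by (simp add: perm_matrix_def mat_def)

lemma w0_w0: "w0 (w0 i) = i" by (simp add: w0_def)

lemma w0_permutes: "w0 permutes UNIV"
  unfolding permutes_def by (metis UNIV_I w0_w0)

lemma inv_w0: "inv_into UNIV w0 = w0" using w0_w0 by (metis inv_equality)

lemma w0_less_iff: "w0 i < w0 j \<longleftrightarrow> j < i"
proof -
  have "\<forall>i j. w0 i < w0 j \<longleftrightarrow> j < i" unfolding all_4_from_0 w0_def by simp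
  then show ?thesis by blast
qed

lemma perm_matrix_inv:
  assumes "w permutes UNIV"
  shows "perm_matrix w ** perm_matrix (inv_into UNIV w) = mat 1"
    "perm_matrix (inv_into UNIV w) ** perm_matrix w = mat 1"
  using assms by (simp_all add: perm_matrix_mult permutes_inv_o perm_matrix_id)

lemma perm_matrix_w0: "perm_matrix w0 ** perm_matrix w0 = mat 1"
  using perm_matrix_inv(1)[OF w0_permutes] by (simp add: inv_w0)

lemma perm_matrix_invertible: "w permutes UNIV \<Longrightarrow> invertible (perm_matrix w)"
  using perm_matrix_inv(1) invertible_right_inverse by blast

lemma transpose_perm_matrix:
  assumes "w permutes UNIV"
  shows "transpose (perm_matrix w) = perm_matrix (inv_into UNIV w)"
proof -
  have "j = w i \<longleftrightarrow> i = inv_into UNIV w j" for i j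
    using assms by (metis permutes_inverses(1) permutes_inverses(2))
  then show ?thesis by (simp add: transpose_def perm_matrix_def)
qed

text \<open>The anti-transposition, lifted from \<open>PGL(4)\<close> to an involutive automorphism of \<open>GL(4)\<close>.\<close>

definition twist :: "complex ^ 4 ^ 4 \<Rightarrow> complex ^ 4 ^ 4"
  where "twist A = perm_matrix w0 ** matrix_inv (transpose A) ** perm_matrix w0"

lemma twist_eqI: "transpose A ** C = mat 1 \<Longrightarrow> twist A = perm_matrix w0 ** C ** perm_matrix w0"
  by (simp add: twist_def matrix_inv_eqI)

lemma contragredient_exists:
  fixes A :: "complex ^ 4 ^ 4"
  assumes "invertible A"
  obtains C where "transpose A ** C = mat 1"
  using invertible_transpose[OF assms] invertible_right_inverse by blast

lemma twist_mult:
  assumes "invertible A" "invertible B"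
  shows "twist (A ** B) = twist A ** twist B"
proof -
  obtain C where C: "transpose A ** C = mat 1" using contragredient_exists[OF assms(1)] .
  obtain D where D: "transpose B ** D = mat 1" using contragredient_exists[OF assms(2)] .
  have "transpose (A ** B) ** (C ** D) = mat 1"
    using C D by (simp add: matrix_transpose_mul matrix_mul_assoc[symmetric] matrix_mul_cancel)
  then show ?thesis
    using twist_eqI[OF C] twist_eqI[OF D] twist_eqI[of "A ** B" "C ** D"]
    by (simp add: matrix_mul_assoc[symmetric] matrix_mul_cancel[OF perm_matrix_w0])
qed

lemma invertible_twist:
  assumes "invertible A"
  shows "invertible (twist A)"
proof -
  obtain C where C: "transpose A ** C = mat 1" using contragredient_exists[OF assms] .
  then have "invertible C" using invertible_left_inverse by blast
  then show ?thesis
    using twist_eqI[OF C] by (auto intro!: invertible_mult perm_matrix_invertible w0_permutes)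
qed

lemma twist_twist:
  assumes "invertible A"
  shows "twist (twist A) = A"
proof -
  obtain C where C: "transpose A ** C = mat 1" using contragredient_exists[OF assms] .
  have "transpose C ** A = mat 1"
    using matrix_transpose_mul[of "transpose A" C] by (simp add: C transpose_mat)
  then have "transpose (twist A) ** (perm_matrix w0 ** A ** perm_matrix w0) = mat 1"
    unfolding twist_eqI[OF C]
    by (simp add: matrix_transpose_mul transpose_perm_matrix w0_permutes inv_w0 perm_matrix_w0
        matrix_mul_assoc[symmetric] matrix_mul_cancel[OF perm_matrix_w0] matrix_mul_cancel)
  from twist_eqI[OF this] show ?thesis
    by (simp add: matrix_mul_assoc[symmetric] matrix_mul_cancel[OF perm_matrix_w0] perm_matrix_w0)
qed

lemma twist_perm_matrix:
  assumes "w permutes UNIV"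
  shows "twist (perm_matrix w) = perm_matrix (w0 \<circ> w \<circ> w0)"
proof -
  have "transpose (perm_matrix w) ** perm_matrix w = mat 1"
    using assms by (simp add: transpose_perm_matrix perm_matrix_inv)
  from twist_eqI[OF this] show ?thesis by (simp add: perm_matrix_mult)
qed

lemma twist_scalar:
  assumes "c \<noteq> 0" "invertible A"
  shows "twist (mat c ** A) = mat (1 / c) ** twist A"
proof -
  have m: "mat c ** mat (1 / c) = (mat 1 :: complex ^ 4 ^ 4)"
    using assms(1) by (simp add: matrix_4_simps mat_def)
  then have c: "twist (mat c) = perm_matrix w0 ** mat (1 / c) ** perm_matrix w0"
    by (intro twist_eqI) (simp only: transpose_mat)
  from m have "invertible (mat c :: complex ^ 4 ^ 4)" using invertible_right_inverse by blast
  moreover have "twist (mat c) = mat (1 / c)"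
    unfolding c 
    by (simp add: matrix_scalar_commute[of "perm_matrix w0"] matrix_mul_assoc[symmetric] perm_matrix_w0)
  ultimately show ?thesis by (simp add: twist_mult assms(2))
qed

text \<open>
  Inverse transposition turns upper triangular matrices into lower triangular ones, and the
  reversal of rows and columns turns these back.
\<close>

lemma twist_upper:
  assumes "A \<in> upper_matrices"
  shows "twist A \<in> upper_matrices"
proof -
  obtain C where C: "transpose A ** C = mat 1"
    using contragredient_exists[OF upper_matrices_invertible[OF assms]] .
  have "transpose C ** A = mat 1"
    using matrix_transpose_mul[of "transpose A" C] by (simp add: C transpose_mat)
  then have "A ** transpose C = mat 1" using matrix_left_right_inverse by blast
  then have "transpose C \<in> upper_matrices" using upper_matrices_inverse assms by blast
  then have "C $ i $ j = 0" if "i < j" for i j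
    using that by (simp add: upper_matrices_def transpose_def)
  then have "twist A $ i $ j = 0" if "j < i" for i j
    using that
    by (simp add: twist_eqI[OF C] perm_matrix_mult_left perm_matrix_mult_right w0_permutes inv_w0
        w0_less_iff matrix_mul_assoc[symmetric])
  then show ?thesis
    using assms invertible_twist by (simp add: upper_matrices_def)
qed

lemma transpose_twist:
  assumes "invertible A"
  shows "transpose (twist A) = twist (transpose A)"
proof -
  obtain C where C: "transpose A ** C = mat 1" using contragredient_exists[OF assms] .
  have "transpose C ** A = mat 1"
    using matrix_transpose_mul[of "transpose A" C] by (simp add: C transpose_mat)
  then have "transpose (transpose A) ** transpose C = mat 1"
    using matrix_left_right_inverse by (metis transpose_transpose)
  then show ?thesis unfolding twist_eqI[OF C]
    by (simp add: twist_eqI matrix_transpose_mul transpose_perm_matrix w0_permutes inv_w0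
        matrix_mul_assoc)
qed

lemma twist_diagonal: "A \<in> diagonal_matrices \<Longrightarrow> twist A \<in> diagonal_matrices"
  by (simp add: diagonal_iff_upper transpose_twist upper_matrices_invertible twist_upper)

lemma twist_image_upper: "twist ` upper_matrices = upper_matrices"
  using twist_upper twist_twist[OF upper_matrices_invertible]
  by (metis image_eqI image_subsetI subsetI subset_antisym)

lemma twist_image_diagonal: "twist ` diagonal_matrices = diagonal_matrices"
  using twist_diagonal twist_twist[OF diagonal_matrices_invertible]
  by (metis image_eqI image_subsetI subsetI subset_antisym)

lemma perm_conjugate_diagonal:
  assumes w: "w permutes UNIV" and D: "D \<in> diagonal_matrices"
  shows "perm_matrix w ** D ** perm_matrix (inv_into UNIV w) \<in> diagonal_matrices"
proof -
  have "inv_into UNIV w i = inv_into UNIV w j \<longleftrightarrow> i = j" for i j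
    using permutes_inj[OF permutes_inv[OF w]] by (simp add: inj_eq)
  then show ?thesis using assms
    by (auto simp: diagonal_matrices_def perm_matrix_mult_left perm_matrix_mult_right
        matrix_mul_assoc[symmetric] intro!: invertible_mult perm_matrix_invertible permutes_inv)
qed

lemma perm_conjugate_image_diagonal:
  assumes w: "w permutes UNIV"
  shows "(\<lambda>D. perm_matrix w ** D ** perm_matrix (inv_into UNIV w)) ` diagonal_matrices = diagonal_matrices"
proof -
  have "perm_matrix w ** (perm_matrix (inv_into UNIV w) ** D ** perm_matrix (inv_into UNIV (inv_into UNIV w)))
      ** perm_matrix (inv_into UNIV w) = D" for D
    using w by (simp add: matrix_mul_assoc[symmetric] permutes_inv_inv perm_matrix_inv matrix_mul_cancel)
  then show ?thesis
    using perm_conjugate_diagonal[OF w] perm_conjugate_diagonal[OF permutes_inv[OF w]]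
    by (metis (no_types, lifting) image_eqI image_subsetI subsetI subset_antisym)
qed


section \<open>Torus orbits of flags\<close>

lemma cls_eq: "cls A = {mat c ** A | c. c \<noteq> 0}"
  by (auto simp: cls_def r_coset_def scalars_def GL4_def)

lemma cls_self: "A \<in> cls A"
  unfolding cls_eq by (rule CollectI, rule exI[of _ 1]) simp

lemma cls_mult: "cls A <#>\<^bsub>GL4\<^esub> cls B = cls (A ** B)"
proof -
  have swap: "mat c ** A ** (mat d ** B) = mat (c * d) ** (A ** B)" for c d
  proof -
    have "mat c ** A ** (mat d ** B) = (mat c ** mat d) ** (A ** B)"
      using matrix_scalar_commute[of A d] by (metis matrix_mul_assoc)
    moreover have "mat c ** mat d = (mat (c * d) :: complex ^ 4 ^ 4)"
      by (simp add: matrix_4_simps mat_def)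
    ultimately show ?thesis by simp
  qed
  have product: "cls A <#>\<^bsub>GL4\<^esub> cls B = {M ** N | M N. M \<in> cls A \<and> N \<in> cls B}"
    by (auto simp: set_mult_def GL4_def)
  show ?thesis
  proof
    show "cls A <#>\<^bsub>GL4\<^esub> cls B \<subseteq> cls (A ** B)"
    proof
      fix M assume "M \<in> cls A <#>\<^bsub>GL4\<^esub> cls B"
      then obtain P Q where "M = P ** Q" and PQ: "P \<in> cls A" "Q \<in> cls B"
        unfolding product by blast
      moreover obtain c where "c \<noteq> 0" "P = mat c ** A" using PQ(1) unfolding cls_eq by blast
      moreover obtain d where "d \<noteq> 0" "Q = mat d ** B" using PQ(2) unfolding cls_eq by blast
      ultimately have "c \<noteq> 0" "d \<noteq> 0" "M = mat c ** A ** (mat d ** B)" by auto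
      then show "M \<in> cls (A ** B)"
        unfolding cls_eq by (intro CollectI exI[of _ "c * d"]) (simp add: swap)
    qed
    show "cls (A ** B) \<subseteq> cls A <#>\<^bsub>GL4\<^esub> cls B"
    proof
      fix M assume "M \<in> cls (A ** B)"
      then obtain c where "c \<noteq> 0" "M = (mat c ** A) ** B"
        unfolding cls_eq by (auto simp: matrix_mul_assoc)
      moreover from this have "mat c ** A \<in> cls A" unfolding cls_eq by blast
      moreover have "B \<in> cls B" by (rule cls_self)
      ultimately show "M \<in> cls A <#>\<^bsub>GL4\<^esub> cls B" unfolding product by blast
    qed
  qed
qed

lemma cls_left_coset: "cls A <#\<^bsub>PGL4\<^esub> ((\<lambda>B. cls (f B)) ` S) = (\<lambda>B. cls (A ** f B)) ` S"
  by (auto simp: l_coset_def PGL4_def FactGroup_def cls_mult)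

lemma flag_of_eq: "flag_of A = (\<lambda>U. cls (A ** U)) ` upper_matrices"
  using cls_left_coset[of A "\<lambda>U. U" upper_matrices]
  by (simp add: flag_of_def borel_subgroup_def upper_matrices_def)

lemma cls_left_coset_flag_of: "cls A <#\<^bsub>PGL4\<^esub> flag_of B = flag_of (A ** B)"
  by (simp add: flag_of_eq cls_left_coset matrix_mul_assoc)

lemma flag_of_mult_upper:
  assumes "U \<in> upper_matrices"
  shows "flag_of (A ** U) = flag_of A"
proof -
  have "flag_of (A ** U) = (\<lambda>V. cls (A ** V)) ` (\<lambda>V. U ** V) ` upper_matrices"
    by (simp add: flag_of_eq image_image matrix_mul_assoc)
  then show ?thesis by (simp add: upper_mult_image[OF assms] flag_of_eq)
qed

text \<open>
  Equal flags only give proportional matrices up to an upper triangular factor, but that factor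
  absorbs the scalar.
\<close>

lemma flag_of_eqD:
  assumes "flag_of A = flag_of B"
  shows "\<exists>U\<in>upper_matrices. B = A ** U"
proof -
  have "cls B \<in> flag_of B"
    using mat_1_upper unfolding flag_of_eq by (metis image_eqI matrix_mul_rid)
  then obtain U where U: "U \<in> upper_matrices" "cls B = cls (A ** U)"
    unfolding assms[symmetric] by (auto simp: flag_of_eq)
  then obtain c where "c \<noteq> 0" "B = mat c ** (A ** U)" using cls_self[of B] by (auto simp: cls_eq)
  then have "mat c ** U \<in> upper_matrices" "B = A ** (mat c ** U)"
    using U upper_matrices_scalar by (simp_all add: matrix_mul_assoc matrix_scalar_commute)
  then show ?thesis by blast
qed

lemma torus_orbit_flag_of: "torus_orbit (flag_of A) = (\<lambda>D. flag_of (D ** A)) ` diagonal_matrices"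
proof -
  have torus: "torus = cls ` diagonal_matrices" by (simp add: torus_def diagonal_matrices_def)
  have "torus_orbit (flag_of A) = (\<lambda>D. cls D <#\<^bsub>PGL4\<^esub> flag_of A) ` diagonal_matrices"
    unfolding torus_orbit_def torus by blast
  then show ?thesis by (simp add: cls_left_coset_flag_of)
qed

text \<open>
  Orbits of the torus \<open>H\<close> on \<open>G/B\<close> are double cosets \<open>H A B\<close>, so that multiplying \<open>A\<close> by diagonal
  matrices on the left and by upper triangular ones on the right changes nothing.
\<close>

lemma torus_orbit_eqI:
  assumes D: "D \<in> diagonal_matrices" and U: "U \<in> upper_matrices" and "B ** U = D ** A"
  shows "torus_orbit (flag_of B) = torus_orbit (flag_of A)"
proof -
  have "flag_of (E ** B) = flag_of (E ** D ** A)" for E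
    using flag_of_mult_upper[OF U, of "E ** B"] assms(3) by (simp add: matrix_mul_assoc[symmetric])
  then have "torus_orbit (flag_of B) = (\<lambda>E. flag_of (E ** A)) ` (\<lambda>E. E ** D) ` diagonal_matrices"
    by (simp add: torus_orbit_flag_of image_image)
  then show ?thesis by (simp add: diagonal_mult_image[OF D] torus_orbit_flag_of)
qed

lemma torus_orbit_eqD:
  assumes "torus_orbit (flag_of A) = torus_orbit (flag_of B)"
  shows "\<exists>D\<in>diagonal_matrices. \<exists>U\<in>upper_matrices. B = D ** A ** U"
proof -
  have "flag_of B \<in> torus_orbit (flag_of B)"
    unfolding torus_orbit_flag_of by (rule image_eqI[OF _ mat_1_diagonal]) simp
  then have "flag_of B \<in> (\<lambda>D. flag_of (D ** A)) ` diagonal_matrices"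
    using torus_orbit_flag_of[of A] assms by simp
  then obtain D where D: "D \<in> diagonal_matrices" "flag_of B = flag_of (D ** A)" by blast
  then show ?thesis using flag_of_eqD[OF D(2)[symmetric]] by blast
qed

text \<open>
  The action lifted to matrices. On invertible matrices it is an honest action of the extended
  Weyl group, because permutation matrices compose and \<open>twist\<close> permutes them by conjugation
  with \<open>w\<^sub>0\<close>.
\<close>

definition act_matrix :: "(4 \<Rightarrow> 4) \<times> bool \<Rightarrow> complex ^ 4 ^ 4 \<Rightarrow> complex ^ 4 ^ 4"
  where "act_matrix = (\<lambda>(w, e) A. perm_matrix w ** (if e then twist A else A))"

lemma anti_transposition_cls:
  assumes "invertible A"
  shows "anti_transposition (cls A) = cls (twist A)"
proof -
  have "anti_transposition (cls A) = {twist (mat c ** A) | c. c \<noteq> 0}"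
    unfolding anti_transposition_def twist_def[symmetric] cls_eq by blast
  also have "\<dots> = {mat (1 / c) ** twist A | c. c \<noteq> 0}"
    using twist_scalar[OF _ assms] by metis
  also have "\<dots> = cls (twist A)"
  proof -
    have "c \<noteq> 0 \<Longrightarrow> c = 1 / (1 / c) \<and> 1 / c \<noteq> 0" for c :: complex by simp
    then show ?thesis unfolding cls_eq by (metis (no_types, opaque_lifting))
  qed
  finally show ?thesis .
qed

lemma anti_transposition_flag_of:
  assumes "invertible A"
  shows "anti_transposition ` flag_of A = flag_of (twist A)"
proof -
  have "anti_transposition ` flag_of A = (\<lambda>U. cls (twist A ** twist U)) ` upper_matrices"
    unfolding flag_of_eq image_image
    by (rule image_cong)
       (auto simp: anti_transposition_cls assms invertible_mult upper_matrices_invertible twist_mult)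
  also have "\<dots> = (\<lambda>U. cls (twist A ** U)) ` twist ` upper_matrices" by (simp add: image_image)
  finally show ?thesis by (simp add: twist_image_upper flag_of_eq)
qed

lemma act_flag_of: "invertible A \<Longrightarrow> act g (flag_of A) = flag_of (act_matrix g A)"
  by (cases g) (auto simp: act_def act_matrix_def anti_transposition_flag_of cls_left_coset_flag_of)

text \<open>
  The torus is normalised by the extended Weyl group, so that orbits are mapped onto orbits.
\<close>

lemma act_torus_orbit:
  assumes A: "invertible A" and g: "g \<in> carrier ext_weyl"
  shows "act g ` torus_orbit (flag_of A) = torus_orbit (flag_of (act_matrix g A))"
proof -
  obtain w e where ge: "g = (w, e)" and w: "w permutes UNIV"
    using g by (auto simp: ext_weyl_def)
  define D' where "D' D = (if e then twist D else D)" for D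
  have D': "D' ` diagonal_matrices = diagonal_matrices"
    using twist_image_diagonal by (auto simp: D'_def)
  have act: "act_matrix g (D ** A) = perm_matrix w ** D' D ** perm_matrix (inv_into UNIV w) ** act_matrix g A"
    if "D \<in> diagonal_matrices" for D
    using that A w unfolding ge act_matrix_def D'_def
    by (simp add: twist_mult diagonal_matrices_invertible)
       (simp add: matrix_mul_assoc[symmetric] perm_matrix_inv matrix_mul_cancel)
  have "act g ` torus_orbit (flag_of A) = (\<lambda>D. flag_of (act_matrix g (D ** A))) ` diagonal_matrices"
    unfolding torus_orbit_flag_of image_image
    by (rule image_cong) (auto simp: act_flag_of A invertible_mult diagonal_matrices_invertible)
  also have "\<dots> = (\<lambda>D. flag_of (D ** act_matrix g A)) `
      (\<lambda>D. perm_matrix w ** D ** perm_matrix (inv_into UNIV w)) ` D' ` diagonal_matrices"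
    by (simp add: image_image act cong: image_cong)
  finally show ?thesis
    by (simp add: D' perm_conjugate_image_diagonal[OF w] torus_orbit_flag_of)
qed

lemma invertible_act_matrix:
  "invertible A \<Longrightarrow> g \<in> carrier ext_weyl \<Longrightarrow> invertible (act_matrix g A)"
  by (auto simp: act_matrix_def ext_weyl_def invertible_twist perm_matrix_invertible intro!: invertible_mult)

lemma act_matrix_mult:
  assumes A: "invertible A" and g: "g \<in> carrier ext_weyl" and h: "h \<in> carrier ext_weyl"
  shows "act_matrix g (act_matrix h A) = act_matrix (g \<otimes>\<^bsub>ext_weyl\<^esub> h) A"
proof -
  obtain w e v d where gh: "g = (w, e)" "h = (v, d)" and wv: "w permutes UNIV" "v permutes UNIV"
    using g h by (auto simp: ext_weyl_def)
  have "invertible (perm_matrix v)" using wv perm_matrix_invertible by blast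
  then show ?thesis
    unfolding gh act_matrix_def ext_weyl_def
    using A by (auto simp: twist_mult invertible_twist twist_twist twist_perm_matrix wv
        perm_matrix_mult matrix_mul_assoc comp_assoc)
qed


section \<open>The point of a general orbit\<close>

text \<open>
  This is \<open>e\<^sup>Y\<close>, expressed by the coordinates \<open>x\<close> (see \<open>mat_exp_Y_matrix\<close>). These coordinates are
  adapted to \<open>e\<^sup>Y\<close> rather than to \<open>Y\<close>: if \<open>a\<close>, \<open>b\<close>, \<open>c\<close> denote the entries in the positions of
  \<open>y\<^sub>1\<close>, \<open>y\<^sub>2\<close>, \<open>y\<^sub>3\<close>, then \<open>[x\<^sub>0 : x\<^sub>1 : x\<^sub>2 : x\<^sub>3] = [1 : 1 - a : b : b - c]\<close>.
\<close>

definition flag_matrix :: "complex ^ 4 \<Rightarrow> complex ^ 4 ^ 4"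
  where "flag_matrix x = mat4
    (1, 0, 0, 0)
    (1, 1, 0, 0)
    (1 - x $ 1 / x $ 0, 1, 1, 0)
    ((x $ 2 - x $ 3) / x $ 0, x $ 2 / x $ 0, 1, 1)"

definition x_coords_inv :: "complex ^ 4 ^ 4"
  where "x_coords_inv = mat4
    (1/6, 0, 0, 0)
    (1/12, -1/6, 0, 0)
    (-1/12, 0, 1/6, 0)
    (-1/36, 1/12, 1/12, -1/6)"

lemma x_coords_inverse:
  "x_coords ** x_coords_inv = mat 1" "x_coords_inv ** x_coords = mat 1"
  by (simp_all add: x_coords_def x_coords_inv_def matrix_4_simps mat_def)

lemma x_coords_cancel:
  "x_coords *v (x_coords_inv *v v) = v" "x_coords_inv *v (x_coords *v v) = v"
  by (simp_all add: matrix_vector_mul_assoc x_coords_inverse)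

lemma x_coords_nth:
  "(x_coords *v y) $ 0 = 6 * y $ 0"
  "(x_coords *v y) $ 1 = 3 * y $ 0 - 6 * y $ 1"
  "(x_coords *v y) $ 2 = 3 * y $ 0 + 6 * y $ 2"
  "(x_coords *v y) $ 3 = 2 * y $ 0 - 3 * y $ 1 + 3 * y $ 2 - 6 * y $ 3"
  by (simp_all add: x_coords_def matrix_vector_mult_def sum_4_from_0)

lemma x_coords_inv_nth_0: "(x_coords_inv *v x) $ 0 = x $ 0 / 6"
  by (simp add: x_coords_inv_def matrix_vector_mult_def sum_4_from_0)

lemma mat_exp_nilpotent:
  assumes "((\<lambda>M. A ** M) ^^ n) (mat 1) = (0 :: complex ^ 'n ^ 'n)"
  shows "mat_exp A = (\<Sum>k<n. (1 / fact k) *\<^sub>R (((\<lambda>M. A ** M) ^^ k) (mat 1)))"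
  unfolding mat_exp_def
proof (rule suminf_finite)
  fix k assume "k \<notin> {..<n}"
  then have "k = (k - n) + n" by simp
  then have "((\<lambda>M. A ** M) ^^ k) (mat 1) = ((\<lambda>M. A ** M) ^^ (k - n)) 0"
    using assms by (metis comp_apply funpow_add)
  moreover have "((\<lambda>M. A ** M) ^^ m) 0 = 0" for m
    by (induction m) (simp_all add: matrix_matrix_mult_def vec_eq_iff)
  ultimately show "(1 / fact k) *\<^sub>R (((\<lambda>M. A ** M) ^^ k) (mat 1)) = 0" by simp
qed simp

lemma mat_exp_Y_matrix:
  assumes "y $ 0 \<noteq> 0"
  shows "mat_exp (Y_matrix y) = flag_matrix (x_coords *v y)"
proof -
  define a b c where abc: "a = y $ 1 / y $ 0" "b = y $ 2 / y $ 0" "c = y $ 3 / y $ 0"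
  let ?Y = "Y_matrix y"
  have Y: "?Y = mat4 (0, 0, 0, 0) (1, 0, 0, 0) (a, 1, 0, 0) (c, b, 1, 0)"
    by (simp add: Y_matrix_def abc)
  have 2: "?Y ** ?Y = mat4 (0, 0, 0, 0) (0, 0, 0, 0) (1, 0, 0, 0) (a + b, 1, 0, 0)"
    unfolding Y by (simp add: matrix_4_simps)
  have 3: "?Y ** mat4 (0, 0, 0, 0) (0, 0, 0, 0) (1, 0, 0, 0) (a + b, 1, 0, 0)
      = mat4 (0, 0, 0, 0) (0, 0, 0, 0) (0, 0, 0, 0) (1, 0, 0, 0)"
    unfolding Y by (simp add: matrix_4_simps)
  have 4: "?Y ** mat4 (0, 0, 0, 0) (0, 0, 0, 0) (0, 0, 0, 0) (1, 0, 0, 0) = 0"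
    unfolding Y by (simp add: matrix_4_simps)
  have "mat_exp ?Y = (\<Sum>k<4. (1 / fact k) *\<^sub>R (((\<lambda>M. ?Y ** M) ^^ k) (mat 1)))"
    by (rule mat_exp_nilpotent) (simp add: numeral_eq_Suc 2 3 4)
  also have "\<dots> = mat 1 + ?Y + (1 / 2) *\<^sub>R (?Y ** ?Y) + (1 / 6) *\<^sub>R (?Y ** (?Y ** ?Y))"
    by (simp add: eval_nat_numeral)
  also have "\<dots> = flag_matrix (x_coords *v y)"
    unfolding 2 3 unfolding Y abc flag_matrix_def using assms
    by (simp add: vec_eq_iff all_4_from_0 x_coords_nth mat_def
        scaleR_conv_of_real[where 'a = complex] field_simps)
  finally show ?thesis .
qed

lemma orbit_at_eq:
  assumes "y $ 0 \<noteq> 0"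
  shows "orbit_at y = torus_orbit (flag_of (flag_matrix (x_coords *v y)))"
  by (simp add: orbit_at_def mat_exp_Y_matrix assms)

definition flag_matrix_inv :: "complex ^ 4 \<Rightarrow> complex ^ 4 ^ 4"
  where "flag_matrix_inv x = mat4
    (1, 0, 0, 0)
    (-1, 1, 0, 0)
    (x $ 1 / x $ 0, -1, 1, 0)
    ((x $ 3 - x $ 1) / x $ 0, 1 - x $ 2 / x $ 0, -1, 1)"

lemma flag_matrix_inverse: "flag_matrix_inv x ** flag_matrix x = mat 1"
  by (simp add: flag_matrix_def flag_matrix_inv_def matrix_4_simps mat_def diff_divide_distrib)

lemma invertible_flag_matrix: "invertible (flag_matrix x)"
  using flag_matrix_inverse invertible_left_inverse by blast

text \<open>
  Distinct points have distinct orbits: the unipotent factor of an LU-decomposition is unique, and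
  a diagonal matrix which preserves the subdiagonal entries \<open>1\<close> under conjugation is scalar.
\<close>

lemma orbit_at_eqD:
  assumes y: "y $ 0 \<noteq> 0" and z: "z $ 0 \<noteq> 0" and "orbit_at y = orbit_at z"
  shows "y $ i * z $ j = y $ j * z $ i"
proof -
  define N where "N = flag_matrix (x_coords *v y)"
  define N' where "N' = flag_matrix (x_coords *v z)"
  obtain D U where D: "D \<in> diagonal_matrices" and U: "U \<in> upper_matrices" and DU: "N' = D ** N ** U"
    using torus_orbit_eqD assms unfolding orbit_at_eq[OF y] orbit_at_eq[OF z] N_def N'_def by blast
  have D0: "D $ i $ k = (if k = i then D $ i $ i else 0)" for i k
    using D by (simp add: diagonal_matrices_def)
  have U0: "U $ 1 $ 0 = 0" "U $ 2 $ 0 = 0" "U $ 3 $ 0 = 0" "U $ 2 $ 1 = 0" "U $ 3 $ 1 = 0" "U $ 3 $ 2 = 0"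
    using U by (auto simp: upper_matrices_def)
  have entry: "N' $ i $ j = D $ i $ i * (N $ i $ 0 * U $ 0 $ j + N $ i $ 1 * U $ 1 $ j
      + N $ i $ 2 * U $ 2 $ j + N $ i $ 3 * U $ 3 $ j)" for i j
  proof -
    have "N' $ i $ j = (\<Sum>k\<in>UNIV. D $ i $ k * (N ** U) $ k $ j)"
      unfolding DU matrix_mul_assoc[symmetric] by (simp add: matrix_matrix_mult_def)
    also have "\<dots> = D $ i $ i * (N ** U) $ i $ j"
      by (subst D0) (simp add: mult_delta_left)
    finally show ?thesis by (simp add: matrix_matrix_mult_def sum_4_from_0)
  qed
  have Nn: "N $ 0 $ 0 = 1" "N $ 0 $ 1 = 0" "N $ 0 $ 2 = 0" "N $ 0 $ 3 = 0" "N $ 1 $ 0 = 1" "N $ 1 $ 1 = 1"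
    "N $ 1 $ 2 = 0" "N $ 1 $ 3 = 0" "N $ 2 $ 1 = 1" "N $ 2 $ 2 = 1" "N $ 2 $ 3 = 0" "N $ 3 $ 2 = 1" "N $ 3 $ 3 = 1"
    "N' $ 0 $ 0 = 1" "N' $ 0 $ 1 = 0" "N' $ 0 $ 2 = 0" "N' $ 0 $ 3 = 0" "N' $ 1 $ 0 = 1" "N' $ 1 $ 1 = 1"
    "N' $ 1 $ 2 = 0" "N' $ 1 $ 3 = 0" "N' $ 2 $ 1 = 1" "N' $ 2 $ 2 = 1" "N' $ 2 $ 3 = 0" "N' $ 3 $ 2 = 1" "N' $ 3 $ 3 = 1"
    by (simp_all add: N_def N'_def flag_matrix_def)
  \<comment> \<open>Going through the first three columns, the entries of \<open>U\<close> above the diagonal vanish, and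
    the subdiagonal entries \<open>1\<close> of \<open>N\<close> and \<open>N'\<close> force the diagonal entries of \<open>D\<close> to agree.\<close>
  have c0: "D $ 0 $ 0 * U $ 0 $ 0 = 1" "D $ 1 $ 1 * U $ 0 $ 0 = 1"
    "N' $ 2 $ 0 = D $ 2 $ 2 * (N $ 2 $ 0 * U $ 0 $ 0)" "N' $ 3 $ 0 = D $ 3 $ 3 * (N $ 3 $ 0 * U $ 0 $ 0)"
    using entry[of 0 0] entry[of 1 0] entry[of 2 0] entry[of 3 0] by (simp_all add: Nn U0)
  have u01: "U $ 0 $ 1 = 0" "U $ 0 $ 2 = 0"
    using entry[of 0 1] entry[of 0 2] c0(1) by (auto simp: Nn U0)
  have c1: "D $ 1 $ 1 * U $ 1 $ 1 = 1" "D $ 2 $ 2 * U $ 1 $ 1 = 1"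
    "N' $ 3 $ 1 = D $ 3 $ 3 * (N $ 3 $ 1 * U $ 1 $ 1)"
    using entry[of 1 1] entry[of 2 1] entry[of 3 1] by (simp_all add: Nn U0 u01)
  have u12: "U $ 1 $ 2 = 0" using entry[of 1 2] c0(2) by (auto simp: Nn U0 u01)
  have c2: "D $ 2 $ 2 * U $ 2 $ 2 = 1" "D $ 3 $ 3 * U $ 2 $ 2 = 1"
    using entry[of 2 2] entry[of 3 2] by (simp_all add: Nn U0 u01 u12)
  have d: "D $ 0 $ 0 = D $ 1 $ 1" "D $ 1 $ 1 = D $ 2 $ 2" "D $ 2 $ 2 = D $ 3 $ 3"
    using c0 c1 c2 by (metis mult_cancel_right mult_zero_right zero_neq_one)+
  have "N' $ 2 $ 0 = N $ 2 $ 0" "N' $ 3 $ 0 = N $ 3 $ 0" "N' $ 3 $ 1 = N $ 3 $ 1"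
    using c0 c1 c2 d by (simp_all add: algebra_simps)
  then have a: "1 - (x_coords *v z) $ 1 / (x_coords *v z) $ 0 = 1 - (x_coords *v y) $ 1 / (x_coords *v y) $ 0"
    and b: "(x_coords *v z) $ 2 / (x_coords *v z) $ 0 = (x_coords *v y) $ 2 / (x_coords *v y) $ 0"
    and c: "((x_coords *v z) $ 2 - (x_coords *v z) $ 3) / (x_coords *v z) $ 0
      = ((x_coords *v y) $ 2 - (x_coords *v y) $ 3) / (x_coords *v y) $ 0"
    by (simp_all add: N_def N'_def flag_matrix_def)
  have r1: "y $ 1 / y $ 0 = z $ 1 / z $ 0" and r2: "y $ 2 / y $ 0 = z $ 2 / z $ 0"
    using a b y z by (simp_all add: x_coords_nth field_simps)
  have "(x_coords *v v) $ 2 - (x_coords *v v) $ 3 =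
      (x_coords *v v) $ 0 * (1/6 + (v $ 1 / v $ 0 + v $ 2 / v $ 0) / 2 + v $ 3 / v $ 0)"
    if "v $ 0 \<noteq> 0" for v
    using that by (simp add: x_coords_nth field_simps)
  moreover have "(x_coords *v y) $ 0 \<noteq> 0" "(x_coords *v z) $ 0 \<noteq> 0"
    using y z by (simp_all add: x_coords_nth)
  ultimately have "y $ 3 / y $ 0 = z $ 3 / z $ 0"
    using c r1 r2 y z by simp
  note r = r1 r2 this
  have "\<forall>i. y $ i = (y $ 0 / z $ 0) * z $ i"
    unfolding all_4_from_0 using r y z by (simp add: field_simps)
  then obtain c where "\<And>i. y $ i = c * z $ i" by blast
  then show ?thesis by simp
qed

text \<open>
  A right factor relating invertible matrices is automatically invertible, so that only its shape
  has to be checked.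
\<close>

lemma torus_orbit_eqI':
  assumes "D \<in> diagonal_matrices" "\<And>i j. j < i \<Longrightarrow> U $ i $ j = 0" "B ** U = D ** A"
    "invertible A" "invertible B"
  shows "torus_orbit (flag_of B) = torus_orbit (flag_of A)"
proof (rule torus_orbit_eqI[OF assms(1) _ assms(3)])
  have "invertible (D ** A)"
    using invertible_mult[OF diagonal_matrices_invertible] assms(1,4) .
  then show "U \<in> upper_matrices" unfolding upper_matrices_def
    using invertible_left_cancel[OF assms(3,5)] assms(2) by simp
qed

lemma diagonal_mat4:
  assumes "p \<noteq> 0" "q \<noteq> 0" "r \<noteq> 0" "s \<noteq> 0"
  shows "mat4 (p, 0, 0, 0) (0, q, 0, 0) (0, 0, r, 0) (0, 0, 0, s) \<in> diagonal_matrices" (is "?D \<in> _")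
proof -
  have "?D ** mat4 (1/p, 0, 0, 0) (0, 1/q, 0, 0) (0, 0, 1/r, 0) (0, 0, 0, 1/s) = mat 1"
    using assms by (simp add: matrix_4_simps mat_def)
  then have "invertible ?D" using invertible_right_inverse by blast
  then show ?thesis by (simp add: diagonal_matrices_def all_4_from_0)
qed

lemma matrix_vector_mat4:
  "R1 *v x = vec4 (x $ 1) (x $ 0) (x $ 3) (x $ 2)"
  "R3 *v x = vec4 (x $ 2) (x $ 3) (x $ 0) (x $ 1)"
  "T *v x = vec4 (x $ 0) (x $ 2) (x $ 1) (x $ 3)"
  by (simp_all add: R1_def R3_def T_def matrix_4_simps matrix_vector_mult_def)

definition cremona :: "complex ^ 4 \<Rightarrow> complex ^ 4"
  where "cremona = (\<lambda>x. vec4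
        ((x $ 1 - x $ 0) * (x $ 2 - x $ 0))
        (x $ 1 * (x $ 2 - x $ 0))
        (x $ 2 * (x $ 1 - x $ 0))
        (x $ 1 * x $ 2 - x $ 0 * x $ 3))"

lemma invertible_act_flag_matrix:
  "g \<in> carrier ext_weyl \<Longrightarrow> invertible (act_matrix g (flag_matrix x))"
  by (simp add: invertible_act_matrix invertible_flag_matrix)

lemma simple_reflection_carrier: "simple_reflection i \<in> carrier ext_weyl"
  by (simp add: simple_reflection_def ext_weyl_def permutes_swap_id)

lemma tau_carrier: "tau \<in> carrier ext_weyl"
  by (simp add: tau_def ext_weyl_def permutes_id)

text \<open>
  The simple reflections are read off from LU-decompositions. In each of them \<open>U\<close> performs the column
  operations that make the permuted matrix lower triangular, with columns scaled by the diagonal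
  matrix \<open>D\<close>, and \<open>D\<close> is the one which makes the subdiagonal entries of
  \<open>D\<^sup>-\<^sup>1 r\<^sub>i e\<^sup>Y U\<close> equal to \<open>1\<close>.
\<close>

lemma act_simple_reflection_1:
  assumes "x $ 0 \<noteq> 0" "(R1 *v x) $ 0 \<noteq> 0"
  shows "torus_orbit (flag_of (act_matrix (simple_reflection 1) (flag_matrix x))) =
    torus_orbit (flag_of (flag_matrix (R1 *v x)))"
proof -
  \<comment> \<open>The scalar \<open>s = a - 1\<close> is the subdiagonal entry in row 2 after subtracting the second
    column from the first.\<close>
  let ?s = "- x $ 1 / x $ 0"
  let ?U = "mat4 (1, 1, 0, 0) (0, -1, 0, 0) (0, 0, ?s, 0) (0, 0, 0, ?s)"
  have nz: "?s \<noteq> 0" using assms by (simp add: matrix_vector_mat4)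
  have eq: "act_matrix (simple_reflection 1) (flag_matrix x) ** ?U =
      mat4 (1, 0, 0, 0) (0, 1, 0, 0) (0, 0, ?s, 0) (0, 0, 0, ?s) ** flag_matrix (R1 *v x)"
    using assms
    by (simp add: act_matrix_def simple_reflection_def perm_matrix_def Transposition.transpose_def
        flag_matrix_def matrix_vector_mat4 matrix_4_simps field_simps)
  have "\<forall>i j. j < i \<longrightarrow> ?U $ i $ j = 0" by (simp add: all_4_from_0)
  then have upper: "?U $ i $ j = 0" if "j < i" for i j using that by blast
  show ?thesis
    by (rule torus_orbit_eqI'[OF diagonal_mat4[OF one_neq_zero one_neq_zero nz nz] upper eq
          invertible_flag_matrix invertible_act_flag_matrix[OF simple_reflection_carrier]])
qed

lemma act_simple_reflection_2:
  assumes "x $ 0 \<noteq> 0" "cremona x $ 0 \<noteq> 0"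
  shows "torus_orbit (flag_of (act_matrix (simple_reflection 2) (flag_matrix x))) =
    torus_orbit (flag_of (flag_matrix (cremona x)))"
proof -
  let ?a = "1 - x $ 1 / x $ 0" and ?b = "x $ 2 / x $ 0"
  let ?U = "mat4 (1, 0, 0, 0) (0, ?a, ?a, 0) (0, 0, - ?a, 0) (0, 0, 0, ?a * (?b - 1))"
  have nz: "x $ 1 \<noteq> x $ 0" "x $ 2 \<noteq> x $ 0" using assms(2) by (simp_all add: cremona_def)
  then have "?a \<noteq> 0" "?b - 1 \<noteq> 0" using assms(1) by (simp_all add: field_simps)
  then have ab: "?a \<noteq> 0" "?a * (?b - 1) \<noteq> 0" by simp_all
  \<comment> \<open>Denominators become products of variables, which simplification can clear.\<close>
  define u v where "u = x $ 1 - x $ 0" "v = x $ 2 - x $ 0"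
  have uv: "x $ 1 = u + x $ 0" "x $ 2 = v + x $ 0" "u \<noteq> 0" "v \<noteq> 0"
    using nz by (simp_all add: u_v_def)
  have eq: "act_matrix (simple_reflection 2) (flag_matrix x) ** ?U =
      mat4 (1, 0, 0, 0) (0, ?a, 0, 0) (0, 0, ?a, 0) (0, 0, 0, ?a * (?b - 1)) ** flag_matrix (cremona x)"
    using assms(1) uv(3,4)
    by (simp add: act_matrix_def simple_reflection_def perm_matrix_def Transposition.transpose_def
        flag_matrix_def cremona_def matrix_4_simps uv(1,2) field_simps)
  have "\<forall>i j. j < i \<longrightarrow> ?U $ i $ j = 0" by (simp add: all_4_from_0)
  then have upper: "?U $ i $ j = 0" if "j < i" for i j using that by blast
  show ?thesis
    by (rule torus_orbit_eqI'[OF diagonal_mat4[OF one_neq_zero ab(1,1,2)] upper eq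
          invertible_flag_matrix invertible_act_flag_matrix[OF simple_reflection_carrier]])
qed

lemma act_simple_reflection_3:
  assumes "x $ 0 \<noteq> 0" "(R3 *v x) $ 0 \<noteq> 0"
  shows "torus_orbit (flag_of (act_matrix (simple_reflection 3) (flag_matrix x))) =
    torus_orbit (flag_of (flag_matrix (R3 *v x)))"
proof -
  let ?b = "x $ 2 / x $ 0"
  let ?U = "mat4 (1, 0, 0, 0) (0, 1, 0, 0) (0, 0, ?b, ?b) (0, 0, 0, - ?b)"
  have nz: "?b \<noteq> 0" using assms by (simp add: matrix_vector_mat4)
  have eq: "act_matrix (simple_reflection 3) (flag_matrix x) ** ?U =
      mat4 (1, 0, 0, 0) (0, 1, 0, 0) (0, 0, ?b, 0) (0, 0, 0, ?b) ** flag_matrix (R3 *v x)"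
    using assms
    by (simp add: act_matrix_def simple_reflection_def perm_matrix_def Transposition.transpose_def
        flag_matrix_def matrix_vector_mat4 matrix_4_simps field_simps)
  have "\<forall>i j. j < i \<longrightarrow> ?U $ i $ j = 0" by (simp add: all_4_from_0)
  then have upper: "?U $ i $ j = 0" if "j < i" for i j using that by blast
  show ?thesis
    by (rule torus_orbit_eqI'[OF diagonal_mat4[OF one_neq_zero one_neq_zero nz nz] upper eq
          invertible_flag_matrix invertible_act_flag_matrix[OF simple_reflection_carrier]])
qed

text \<open>
  Here no column operations are needed: \<open>(e\<^sup>Y)\<^sup>-\<^sup>1 = e\<^bsup>-Y\<^esup>\<close>, and reversing it along the
  antidiagonal gives a lower unipotent matrix with subdiagonal entries \<open>-1\<close>, whose signs are
  corrected by conjugation with \<open>diag(1, -1, 1, -1)\<close>.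
\<close>

lemma act_tau:
  assumes "x $ 0 \<noteq> 0"
  shows "torus_orbit (flag_of (act_matrix tau (flag_matrix x))) =
    torus_orbit (flag_of (flag_matrix (T *v x)))"
proof -
  let ?D = "mat4 (1, 0, 0, 0) (0, -1, 0, 0) (0, 0, 1, 0) (0, 0, 0, -1) :: complex ^ 4 ^ 4"
  have "transpose (flag_matrix x) ** transpose (flag_matrix_inv x) = mat 1"
    by (simp add: matrix_transpose_mul[symmetric] flag_matrix_inverse)
  note twist_eqI[OF this]
  moreover have "(perm_matrix w0 ** transpose (flag_matrix_inv x) ** perm_matrix w0) $ i $ j
      = flag_matrix_inv x $ w0 j $ w0 i" for i j
    by (simp add: matrix_mul_assoc[symmetric] perm_matrix_mult_left[OF w0_permutes] inv_w0
        perm_matrix_mult_right transpose_def)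
  moreover define K where "K = twist (flag_matrix x)"
  ultimately have K: "K $ i $ j = flag_matrix_inv x $ w0 j $ w0 i" for i j
    by simp
  have "K ** ?D = ?D ** flag_matrix (T *v x)"
    using assms
    by (simp add: matrix_4_simps K w0_def flag_matrix_inv_def flag_matrix_def
        matrix_vector_mat4 field_simps)
  moreover have D: "?D \<in> diagonal_matrices" by (rule diagonal_mat4) simp_all
  ultimately have eq: "act_matrix tau (flag_matrix x) ** ?D = ?D ** flag_matrix (T *v x)"
    by (simp add: act_matrix_def tau_def perm_matrix_id K_def)
  have "\<forall>i j. j < i \<longrightarrow> ?D $ i $ j = 0" by (simp add: all_4_from_0)
  then have upper: "?D $ i $ j = 0" if "j < i" for i j using that by blast
  show ?thesis
    by (rule torus_orbit_eqI'[OF D upper eq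
          invertible_flag_matrix invertible_act_flag_matrix[OF tau_carrier]])
qed


section \<open>The action on the space of orbits\<close>

text \<open>
  Birational maps are dominant, so preimages of dense open sets are dense and open. This is what
  allows the composition of actions that are known at general points only.
\<close>

lemma generic_pullback:
  assumes "generic P" and h: "birational h"
  shows "generic (\<lambda>y. P (h y))"
proof -
  obtain d q a where q: "homogeneous_poly d q" "q a \<noteq> 0" "\<And>v. v \<noteq> 0 \<Longrightarrow> q v \<noteq> 0 \<Longrightarrow> P v"
    using assms(1) unfolding generic_def by metis
  obtain k where "(h \<circ> k, id) \<in> rat_rel" using birational_inverse[OF h] by blast
  then obtain v where v: "q (h v) \<noteq> 0" using dominant_nonzero[OF _ q(1,2)] by blast
  obtain e where e: "\<And>i. homogeneous_poly e (\<lambda>v. h v $ i)"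
    using rat_rep_degree[OF birational_rat_rep[OF h]] by blast
  have "generic (\<lambda>y. q (h y) \<noteq> 0)"
    unfolding generic_def using homogeneous_poly_compose[OF q(1) e] v by blast
  from generic_conj[OF this generic_nonzero[OF birational_rat_rep[OF h]]]
  show ?thesis by (rule generic_mono) (use q(3) in blast)
qed

lemma act_mult_orbit_at:
  assumes "y $ 0 \<noteq> 0" "g \<in> carrier ext_weyl" "h \<in> carrier ext_weyl"
    "g \<otimes>\<^bsub>ext_weyl\<^esub> h \<in> carrier ext_weyl"
  shows "act (g \<otimes>\<^bsub>ext_weyl\<^esub> h) ` orbit_at y = act g ` act h ` orbit_at y"
  using assms
  by (simp add: orbit_at_eq act_torus_orbit invertible_flag_matrix invertible_act_matrix act_matrix_mult)

lemma ext_weyl_mult_closed: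
  assumes "g \<in> carrier ext_weyl" "h \<in> carrier ext_weyl"
  shows "g \<otimes>\<^bsub>ext_weyl\<^esub> h \<in> carrier ext_weyl"
  using assms by (auto simp: ext_weyl_def intro!: permutes_compose w0_permutes)

lemma Bir_carrierD:
  assumes "\<Phi> \<in> carrier Bir" "f \<in> \<Phi>"
  shows "birational f" "\<Phi> = rat_map f"
proof -
  obtain f' where f': "\<Phi> = rat_map f'" "birational f'" using assms(1) by (auto simp: carrier_Bir)
  then have "(f', f) \<in> rat_rel" using assms(2) by (simp add: mem_rat_map)
  then show "birational f" "\<Phi> = rat_map f"
    using f' birational_cong by (auto simp: rat_map_eq_iff rat_rel_rat_rep)
qed

lemma induces_mult:
  assumes g: "g \<in> carrier ext_weyl" and h: "h \<in> carrier ext_weyl"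
    and "\<Phi> \<in> carrier Bir" "induces g \<Phi>" "\<Psi> \<in> carrier Bir" "induces h \<Psi>"
  shows "induces (g \<otimes>\<^bsub>ext_weyl\<^esub> h) (\<Phi> \<otimes>\<^bsub>Bir\<^esub> \<Psi>)"
proof -
  obtain f where f: "f \<in> \<Phi>"
    and gf: "generic (\<lambda>y. y $ 0 \<noteq> 0 \<and> f y $ 0 \<noteq> 0 \<and> act g ` orbit_at y = orbit_at (f y))"
    using assms(4) by (auto simp: induces_def)
  obtain k where k: "k \<in> \<Psi>"
    and hk: "generic (\<lambda>y. y $ 0 \<noteq> 0 \<and> k y $ 0 \<noteq> 0 \<and> act h ` orbit_at y = orbit_at (k y))"
    using assms(6) by (auto simp: induces_def)
  note F = Bir_carrierD[OF assms(3) f] and K = Bir_carrierD[OF assms(5) k]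
  have "f \<circ> k \<in> \<Phi> \<otimes>\<^bsub>Bir\<^esub> \<Psi>"
    using F K by (simp add: Bir_mult mem_rat_map rat_rel_refl birational_rat_rep birational_comp)
  moreover have "generic (\<lambda>y. y $ 0 \<noteq> 0 \<and> (f \<circ> k) y $ 0 \<noteq> 0 \<and>
      act (g \<otimes>\<^bsub>ext_weyl\<^esub> h) ` orbit_at y = orbit_at ((f \<circ> k) y))"
    by (rule generic_mono[OF generic_conj[OF hk generic_pullback[OF gf K(1)]]])
       (simp add: act_mult_orbit_at ext_weyl_mult_closed g h)
  ultimately show ?thesis unfolding induces_def by blast
qed

lemma induces_unique:
  assumes "\<Phi> \<in> carrier Bir" "induces g \<Phi>" "\<Psi> \<in> carrier Bir" "induces g \<Psi>"
  shows "\<Phi> = \<Psi>"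
proof -
  obtain f where f: "f \<in> \<Phi>"
    and gf: "generic (\<lambda>y. y $ 0 \<noteq> 0 \<and> f y $ 0 \<noteq> 0 \<and> act g ` orbit_at y = orbit_at (f y))"
    using assms(2) by (auto simp: induces_def)
  obtain k where k: "k \<in> \<Psi>"
    and gk: "generic (\<lambda>y. y $ 0 \<noteq> 0 \<and> k y $ 0 \<noteq> 0 \<and> act g ` orbit_at y = orbit_at (k y))"
    using assms(4) by (auto simp: induces_def)
  note F = Bir_carrierD[OF assms(1) f] and K = Bir_carrierD[OF assms(3) k]
  have "(f, k) \<in> rat_rel"
  proof (rule rat_rel_genericI)
    show "generic (\<lambda>y. \<forall>i j. f y $ i * k y $ j = f y $ j * k y $ i)"
      by (rule generic_mono[OF generic_conj[OF gf gk]]) (metis orbit_at_eqD)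
  qed (use F K birational_rat_rep in auto)
  then show ?thesis using F K by (simp add: rat_map_eq_iff birational_rat_rep)
qed

lemma tile_hom_eqI:
  assumes "\<Phi> \<in> carrier Bir" "induces g \<Phi>"
  shows "tile_hom g = \<Phi>"
  unfolding tile_hom_def using assms induces_unique by (intro the_equality) blast+

text \<open>
  A map \<open>F\<close> in the coordinates \<open>x\<close> describes the action of \<open>g\<close> as soon as \<open>g e\<^sup>Y\<close> and the
  unipotent matrix belonging to \<open>F x\<close> define the same torus orbit of flags wherever \<open>x\<close> and
  \<open>F x\<close> lie in the affine chart. Such points are general because \<open>F\<close> is dominant.
\<close>

lemma tile_hom_in_x_coords:
  assumes g: "g \<in> carrier ext_weyl" and F: "birational F"
    and act: "\<And>x. x $ 0 \<noteq> 0 \<Longrightarrow> F x $ 0 \<noteq> 0 \<Longrightarrow>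
      torus_orbit (flag_of (act_matrix g (flag_matrix x))) = torus_orbit (flag_of (flag_matrix (F x)))"
  shows "tile_hom g \<in> carrier Bir" "induces g (tile_hom g)" "in_x_coords (tile_hom g) = rat_map F"
proof -
  let ?X = "\<lambda>v. x_coords *v v" and ?Z = "\<lambda>v. x_coords_inv *v v"
  define f where "f = ?Z \<circ> (F \<circ> ?X)"
  have X: "birational ?X" and Z: "birational ?Z"
    using birational_linear_map x_coords_inverse by blast+
  have f: "birational f" unfolding f_def using X Z F by (intro birational_comp)
  have "generic (\<lambda>x. x $ 0 \<noteq> 0 \<and> F x $ 0 \<noteq> 0)"
  proof -
    obtain k where k: "(F \<circ> k, id) \<in> rat_rel" using birational_inverse[OF F] by blast
    obtain d where d: "\<And>i. homogeneous_poly d (\<lambda>v. F v $ i)"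
      using rat_rep_degree[OF birational_rat_rep[OF F]] by blast
    have e: "(axis 0 1 :: complex ^ 4) $ 0 \<noteq> 0" by simp
    obtain v where v: "F v $ 0 \<noteq> 0"
      using dominant_nonzero[OF k homogeneous_poly.coord[of 0] e] by blast
    have "generic (\<lambda>x :: complex ^ 4. x $ 0 \<noteq> 0)"
      unfolding generic_def using homogeneous_poly.coord[of 0] e by blast
    moreover have "generic (\<lambda>x. F x $ 0 \<noteq> 0)"
      unfolding generic_def using d[of 0] v by blast
    ultimately show ?thesis by (rule generic_conj)
  qed
  from generic_pullback[OF this X]
  have "generic (\<lambda>y. y $ 0 \<noteq> 0 \<and> f y $ 0 \<noteq> 0 \<and> act g ` orbit_at y = orbit_at (f y))"
  proof (rule generic_mono)
    fix y
    assume y: "(x_coords *v y) $ 0 \<noteq> 0 \<and> F (x_coords *v y) $ 0 \<noteq> 0"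
    then have "y $ 0 \<noteq> 0" "f y $ 0 \<noteq> 0"
      by (simp_all add: x_coords_nth f_def x_coords_inv_nth_0)
    moreover have "x_coords *v f y = F (x_coords *v y)" by (simp add: f_def x_coords_cancel)
    ultimately show "y $ 0 \<noteq> 0 \<and> f y $ 0 \<noteq> 0 \<and> act g ` orbit_at y = orbit_at (f y)"
      using y act by (simp add: orbit_at_eq act_torus_orbit invertible_flag_matrix g)
  qed
  moreover have "f \<in> rat_map f" using f by (simp add: mem_rat_map rat_rel_refl birational_rat_rep)
  ultimately have ind: "induces g (rat_map f)" unfolding induces_def by blast
  have t: "tile_hom g = rat_map f" by (rule tile_hom_eqI[OF rat_map_in_Bir[OF f] ind])
  then show "tile_hom g \<in> carrier Bir" "induces g (tile_hom g)"
    using rat_map_in_Bir[OF f] ind by simp_all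
  have "?Z \<circ> ?X = id" "?X \<circ> ?Z = id" by (auto simp: fun_eq_iff x_coords_cancel)
  then have "rat_map ?Z \<otimes>\<^bsub>Bir\<^esub> rat_map ?X = \<one>\<^bsub>Bir\<^esub>" using X Z by (simp add: Bir_mult Bir_one)
  then have "inv\<^bsub>Bir\<^esub> (linear_map x_coords) = rat_map ?Z"
    unfolding linear_map_def by (rule group.inv_equality[OF group_Bir]) (auto intro: rat_map_in_Bir X Z)
  then have "in_x_coords (tile_hom g) = rat_map (?X \<circ> f \<circ> ?Z)"
    by (simp add: in_x_coords_def t linear_map_def Bir_mult X Z f birational_comp)
  also have "?X \<circ> f \<circ> ?Z = F" by (auto simp: fun_eq_iff f_def x_coords_cancel)
  finally show "in_x_coords (tile_hom g) = rat_map F" .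
qed

lemma R1_R3_T_involutions: "R1 ** R1 = mat 1" "R3 ** R3 = mat 1" "T ** T = mat 1"
  by (simp_all add: R1_def R3_def T_def matrix_4_simps mat_def)

lemma rat_rep_cremona: "rat_rep cremona"
proof (rule rat_repI)
  have c: "homogeneous_poly 1 (\<lambda>x. x $ i)" "homogeneous_poly 1 (\<lambda>x. x $ i - x $ j)"
    for i j :: 4
    by (intro homogeneous_poly_diff homogeneous_poly.coord)+
  have "\<forall>i. homogeneous_poly (1 + 1) (\<lambda>x. cremona x $ i)"
    unfolding all_4_from_0 cremona_def vec4_nth
    by (intro conjI homogeneous_poly_diff homogeneous_poly.mult c)
  then show "homogeneous_poly (1 + 1) (\<lambda>x. cremona x $ i)" for i by blast
  have "cremona (vec4 0 1 1 0) $ 0 \<noteq> 0" by (simp add: cremona_def)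
  then show "cremona (vec4 0 1 1 0) \<noteq> 0" by auto
qed

lemma birational_cremona: "birational cremona"
proof (rule birational_involution[OF rat_rep_cremona])
  obtain d where d: "\<And>i. homogeneous_poly d (\<lambda>v. cremona v $ i)"
    using rat_rep_degree[OF rat_rep_cremona] by blast
  have "(cremona \<circ> cremona) (vec4 1 2 3 0) $ 0 \<noteq> 0" by (simp add: cremona_def)
  then have "(cremona \<circ> cremona) (vec4 1 2 3 0) \<noteq> 0" by auto
  then have "rat_rep (cremona \<circ> cremona)"
    using homogeneous_poly_compose[OF d d] by (intro rat_repI[of "d * d"]) auto
  moreover have "(cremona \<circ> cremona) v $ i * id v $ j = (cremona \<circ> cremona) v $ j * id v $ i" for v i j
  proof -
    \<comment> \<open>The common factor of the four quartics which make up \<open>cremona \<circ> cremona\<close>.\<close>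
    define c where "c = (v $ 1 - v $ 0) * (v $ 2 - v $ 0) * v $ 0"
    have "\<forall>i. (cremona \<circ> cremona) v $ i = c * v $ i"
      unfolding all_4_from_0 c_def by (simp add: cremona_def algebra_simps)
    then show ?thesis by simp
  qed
  ultimately show "(cremona \<circ> cremona, id) \<in> rat_rel"
    using rat_rep_id by (simp add: rat_rel_def)
qed


section \<open>Generators of the extended Weyl group\<close>

text \<open>
  Three adjacent transpositions generate \<open>S\<^sub>4\<close>; the factor \<open>\<tau>\<^sup>e\<close> stands on the right and is
  not affected by multiplication with permutations from the left.
\<close>

lemma ext_weyl_induct [consumes 1, case_names one mult]:
  assumes "g \<in> carrier ext_weyl"
    and one: "P \<one>\<^bsub>ext_weyl\<^esub>"
    and mult: "\<And>s h. s \<in> {simple_reflection 1, simple_reflection 2, simple_reflection 3, tau} \<Longrightarrow>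
      h \<in> carrier ext_weyl \<Longrightarrow> P h \<Longrightarrow> P (s \<otimes>\<^bsub>ext_weyl\<^esub> h)"
  shows "P g"
proof -
  obtain w e where g: "g = (w, e)" and w: "w permutes UNIV"
    using assms(1) by (auto simp: ext_weyl_def)
  \<comment> \<open>The permutations by which one may multiply from the left without leaving \<open>P\<close>.\<close>
  define Q where "Q \<sigma> \<longleftrightarrow> (\<forall>p. p permutes UNIV \<longrightarrow> P (p, e) \<longrightarrow> P (\<sigma> \<circ> p, e))" for \<sigma> :: "4 \<Rightarrow> 4"
  let ?t = "Transposition.transpose :: 4 \<Rightarrow> 4 \<Rightarrow> 4 \<Rightarrow> 4"
  have comp: "Q (\<sigma> \<circ> \<rho>)" if "Q \<sigma>" "Q \<rho>" "\<rho> permutes UNIV" for \<sigma> \<rho>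
    using that unfolding Q_def comp_assoc by (auto intro: permutes_compose)
  have adj: "Q (?t (i - 1) i)" if "i \<in> {1, 2, 3}" for i
    unfolding Q_def
  proof (intro allI impI)
    fix p assume "p permutes UNIV" "P (p, e)"
    then show "P (?t (i - 1) i \<circ> p, e)"
      using mult[of "simple_reflection i" "(p, e)"] that
      by (auto simp: ext_weyl_def simple_reflection_def)
  qed
  have t: "?t a b permutes UNIV" for a b by (simp add: permutes_swap_id)
  have q1: "Q (?t 0 1)" "Q (?t 1 2)" "Q (?t 2 3)" using adj[of 1] adj[of 2] adj[of 3] by simp_all
  have "?t 0 2 = ?t 0 1 \<circ> ?t 1 2 \<circ> ?t 0 1" "?t 1 3 = ?t 1 2 \<circ> ?t 2 3 \<circ> ?t 1 2"
    "?t 0 3 = ?t 0 1 \<circ> ?t 1 3 \<circ> ?t 0 1"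
    by (simp_all add: transpose_comp_triple)
  then have q2: "Q (?t 0 2)" "Q (?t 1 3)" "Q (?t 0 3)"
    using q1 comp t permutes_compose[OF t t] by metis+
  have "\<forall>a b. Q (?t a b)"
    unfolding all_4_from_0
    using q1 q2 by (simp add: transpose_commute[of 1 0] transpose_commute[of 2 0] transpose_commute[of 2 1]
        transpose_commute[of 3 0] transpose_commute[of 3 1] transpose_commute[of 3 2])
       (simp add: Q_def)
  then have step: "P (?t a b \<circ> p, e)" if "P (p, e)" "p permutes UNIV" for a b p
    using that by (simp add: Q_def)
  have base: "P (id, e)"
  proof (cases e)
    case True
    have "tau \<otimes>\<^bsub>ext_weyl\<^esub> \<one>\<^bsub>ext_weyl\<^esub> = (id, True)"
      by (simp add: tau_def ext_weyl_def fun_eq_iff w0_w0)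
    then show ?thesis
      using mult[of tau "\<one>\<^bsub>ext_weyl\<^esub>"] one True by (simp add: ext_weyl_def permutes_id)
  next
    case False
    then show ?thesis using one by (simp add: ext_weyl_def)
  qed
  have "P (w, e)"
    using w finite_class.finite_UNIV
  proof (induction rule: permutes_induct)
    case id
    show ?case by (rule base)
  next
    case (swap a b p)
    then show ?case using step by blast
  qed
  then show ?thesis by (simp add: g)
qed

lemma ext_weyl_generators_involutive:
  assumes "s \<in> {simple_reflection 1, simple_reflection 2, simple_reflection 3, tau}"
  shows "s \<in> carrier ext_weyl" "s \<otimes>\<^bsub>ext_weyl\<^esub> s = \<one>\<^bsub>ext_weyl\<^esub>"
  using assms
  by (auto simp: simple_reflection_carrier tau_carrier)
     (auto simp: simple_reflection_def tau_def ext_weyl_def fun_eq_iff w0_w0)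

lemma induces_one: "induces \<one>\<^bsub>ext_weyl\<^esub> \<one>\<^bsub>Bir\<^esub>"
proof -
  have "act \<one>\<^bsub>ext_weyl\<^esub> ` orbit_at y = orbit_at (id y)" if "y $ 0 \<noteq> 0" for y
  proof -
    have "\<one>\<^bsub>ext_weyl\<^esub> \<in> carrier ext_weyl" by (simp add: ext_weyl_def permutes_id)
    moreover have "act_matrix \<one>\<^bsub>ext_weyl\<^esub> A = A" for A
      by (simp add: act_matrix_def ext_weyl_def perm_matrix_id)
    ultimately show ?thesis using that by (simp add: orbit_at_eq act_torus_orbit invertible_flag_matrix)
  qed
  moreover have "(axis 0 1 :: complex ^ 4) $ 0 \<noteq> 0" by simp
  then have "generic (\<lambda>y :: complex ^ 4. y $ 0 \<noteq> 0)"
    unfolding generic_def using homogeneous_poly.coord[of 0] by blast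
  ultimately have "generic (\<lambda>y. y $ 0 \<noteq> 0 \<and> id y $ 0 \<noteq> 0 \<and>
      act \<one>\<^bsub>ext_weyl\<^esub> ` orbit_at y = orbit_at (id y))"
    by (elim generic_mono) simp
  moreover have "id \<in> \<one>\<^bsub>Bir\<^esub>" by (simp add: Bir_one mem_rat_map rat_rel_refl rat_rep_id)
  ultimately show ?thesis unfolding induces_def by blast
qed

lemmas tile_hom_simple_reflection_1 = tile_hom_in_x_coords[OF simple_reflection_carrier
    birational_linear_map[OF R1_R3_T_involutions(1)] act_simple_reflection_1]

lemmas tile_hom_simple_reflection_2 = tile_hom_in_x_coords[OF simple_reflection_carrier
    birational_cremona act_simple_reflection_2]

lemmas tile_hom_simple_reflection_3 = tile_hom_in_x_coords[OF simple_reflection_carrier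
    birational_linear_map[OF R1_R3_T_involutions(2)] act_simple_reflection_3]

lemmas tile_hom_tau = tile_hom_in_x_coords[OF tau_carrier
    birational_linear_map[OF R1_R3_T_involutions(3)] act_tau]

lemma tile_hom_generators:
  assumes "s \<in> {simple_reflection 1, simple_reflection 2, simple_reflection 3, tau}"
  shows "tile_hom s \<in> carrier Bir" "induces s (tile_hom s)"
  using assms tile_hom_simple_reflection_1(1,2) tile_hom_simple_reflection_2(1,2)
    tile_hom_simple_reflection_3(1,2) tile_hom_tau(1,2) by auto

text \<open>
  Maps inducing the generators multiply to maps inducing every element, so the definite
  description behind \<open>tile_hom\<close> is met on the whole group; by uniqueness it is a homomorphism.
\<close>

lemma tile_hom_induces:
  assumes "g \<in> carrier ext_weyl"
  shows "tile_hom g \<in> carrier Bir \<and> induces g (tile_hom g)"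
proof -
  have "\<exists>\<Phi>\<in>carrier Bir. induces g \<Phi>"
    using assms
  proof (induction rule: ext_weyl_induct)
    case one
    show ?case
      using induces_one by (intro bexI[of _ "\<one>\<^bsub>Bir\<^esub>"]) (auto simp: Bir_one rat_map_in_Bir birational_id)
  next
    case (mult s h)
    then obtain \<Phi> where "\<Phi> \<in> carrier Bir" "induces h \<Phi>" by blast
    then have "induces (s \<otimes>\<^bsub>ext_weyl\<^esub> h) (tile_hom s \<otimes>\<^bsub>Bir\<^esub> \<Phi>)"
      using mult.hyps tile_hom_generators ext_weyl_generators_involutive(1)
      by (intro induces_mult) auto
    moreover have "tile_hom s \<otimes>\<^bsub>Bir\<^esub> \<Phi> \<in> carrier Bir"
      using \<open>\<Phi> \<in> carrier Bir\<close> tile_hom_generators(1)[OF mult.hyps(1)]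
      by (intro monoid.m_closed group.is_monoid[OF group_Bir])
    ultimately show ?case by blast
  qed
  then obtain \<Phi> where "\<Phi> \<in> carrier Bir" "induces g \<Phi>" by blast
  then show ?thesis using tile_hom_eqI[of \<Phi> g] by simp
qed

lemma tile_hom_mult:
  assumes "g \<in> carrier ext_weyl" "h \<in> carrier ext_weyl"
  shows "tile_hom (g \<otimes>\<^bsub>ext_weyl\<^esub> h) = tile_hom g \<otimes>\<^bsub>Bir\<^esub> tile_hom h"
  using assms tile_hom_induces
  by (intro tile_hom_eqI induces_mult monoid.m_closed group.is_monoid[OF group_Bir]) auto

lemma tile_hom_one: "tile_hom \<one>\<^bsub>ext_weyl\<^esub> = \<one>\<^bsub>Bir\<^esub>"
  using induces_one by (intro tile_hom_eqI) (auto simp: Bir_one rat_map_in_Bir birational_id)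

text \<open>
  The generators are involutions, so the subgroup they generate contains nothing but their products.
\<close>

lemma tile_group_generated:
  "tile_group = generate Bir
    (tile_hom ` {simple_reflection 1, simple_reflection 2, simple_reflection 3, tau})"
  (is "_ = generate Bir (tile_hom ` ?S)")
proof
  show "tile_group \<subseteq> generate Bir (tile_hom ` ?S)"
  proof
    fix \<Phi> assume "\<Phi> \<in> tile_group"
    then obtain g where g: "g \<in> carrier ext_weyl" "\<Phi> = tile_hom g" by (auto simp: tile_group_def)
    from g(1) have "tile_hom g \<in> generate Bir (tile_hom ` ?S)"
    proof (induction rule: ext_weyl_induct)
      case one
      show ?case unfolding tile_hom_one by (rule generate.one)
    next
      case (mult s h)
      have "tile_hom s \<in> generate Bir (tile_hom ` ?S)"
        by (rule generate.incl) (rule imageI[OF mult.hyps(1)])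
      then show ?case
        using generate.eng[OF _ mult.IH] mult.hyps
        by (simp only: tile_hom_mult ext_weyl_generators_involutive(1))
    qed
    then show "\<Phi> \<in> generate Bir (tile_hom ` ?S)" by (simp add: g)
  qed
  show "generate Bir (tile_hom ` ?S) \<subseteq> tile_group"
  proof
    fix \<Phi> assume "\<Phi> \<in> generate Bir (tile_hom ` ?S)"
    then show "\<Phi> \<in> tile_group"
    proof induction
      case one
      have "\<one>\<^bsub>ext_weyl\<^esub> \<in> carrier ext_weyl" by (simp add: ext_weyl_def permutes_id)
      then show ?case unfolding tile_group_def tile_hom_one[symmetric] by (rule imageI)
    next
      case (incl \<Psi>)
      then show ?case unfolding tile_group_def using ext_weyl_generators_involutive(1) by blast
    next
      case (inv \<Psi>)
      then obtain s where s: "s \<in> ?S" "\<Psi> = tile_hom s" by blast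
      note s' = ext_weyl_generators_involutive[OF s(1)]
      have "\<Psi> \<otimes>\<^bsub>Bir\<^esub> \<Psi> = \<one>\<^bsub>Bir\<^esub>"
        unfolding s(2) tile_hom_mult[OF s'(1,1), symmetric] s'(2) by (rule tile_hom_one)
      then have "inv\<^bsub>Bir\<^esub> \<Psi> = \<Psi>"
        using tile_hom_generators(1)[OF s(1)] s(2) by (intro group.inv_equality[OF group_Bir]) simp_all
      then show ?case unfolding tile_group_def s(2) using s'(1) by simp
    next
      case (eng \<Phi> \<Psi>)
      then obtain g h where "g \<in> carrier ext_weyl" "h \<in> carrier ext_weyl" "\<Phi> = tile_hom g" "\<Psi> = tile_hom h"
        by (auto simp: tile_group_def)
      then show ?case
        unfolding tile_group_def using tile_hom_mult[of g h] ext_weyl_mult_closed[of g h]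
        by (metis image_eqI)
    qed
  qed
qed

theorem proposition5p3:
  shows "tile_group = generate Bir
      {tile_hom (simple_reflection 1), tile_hom (simple_reflection 2),
       tile_hom (simple_reflection 3), tile_hom tau}
    \<and> in_x_coords (tile_hom (simple_reflection 1)) = linear_map R1
    \<and> in_x_coords (tile_hom (simple_reflection 3)) = linear_map R3
    \<and> in_x_coords (tile_hom tau) = linear_map T
    \<and> in_x_coords (tile_hom (simple_reflection 2)) = rat_map (\<lambda>x. vec4
        ((x $ 1 - x $ 0) * (x $ 2 - x $ 0))
        (x $ 1 * (x $ 2 - x $ 0))
        (x $ 2 * (x $ 1 - x $ 0))
        (x $ 1 * x $ 2 - x $ 0 * x $ 3))"
  using tile_group_generated tile_hom_simple_reflection_1(3) tile_hom_simple_reflection_3(3)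
    tile_hom_tau(3) tile_hom_simple_reflection_2(3)[unfolded cremona_def]
  by (simp add: linear_map_def)

end
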